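(* Let there exist $P\in\mathbb R^{m_1\times m_2}$ with corresponding $M=\begin{pmatrix}0&P\\ P^T&0\end{pmatrix}$, a real symmetric matrix $R=R^T$ and a real matrix $K$ such that $$\begin{pmatrix}I&0\\ A_\Psi&B_\Psi J\\ C_\Psi&D_\Psi J\end{pmatrix}^T\begin{pmatrix}0&R&0\\ R&0&0\\ 0&0&M\end{pmatrix}\begin{pmatrix}I&0\\ A_\Psi&B_\Psi J\\ C_\Psi&D_\Psi J\end{pmatrix}\succ0\quad\text{and}\quad\begin{pmatrix}R_{11}&R_{12}-K\\ R_{21}-K^T&R_{22}\end{pmatrix}\prec0 .$$ Then any $\Delta\in\boldsymbol\Delta$ satisfies a finite-horizon IQC with terminal cost matrix $\begin{pmatrix}0&K\\ K^T&0\end{pmatrix}$ (with respect to the factorization $\Pi=[\Psi T]^*M[\Psi T]$).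
   Context: $L_{2e}^n$ is the space of locally square integrable signals $[0,\infty)\to\mathbb R^n$. $\prec,\succ$ refer to definiteness of symmetric matrices; $\mathrm{col}$ stacks vectors; for a real rational matrix, $\Psi^*(s)=\Psi(-s)^T$. Let $\alpha,\beta\in\mathbb R$ be fixed with $0\in(\alpha,\beta)$, and let $n_w=n_z$. $\boldsymbol\Delta$ is the class of multiplication operators $\Delta_\delta:L_{2e}^{n_z}\to L_{2e}^{n_z}$, $\Delta_\delta(z)(t)=\delta z(t)$ for $t\ge0$, with arbitrary $\delta\in[\alpha,\beta]$. For $j=1,2$, $\psi_j$ is a fixed stable proper real rational transfer matrix of size $m_j\times n_z$ with minimal state-space realization $\psi_j(s)=C_j(sI-A_j)^{-1}B_j+D_j$ (so $A_j$ is Hurwitz). Put $\Psi=\mathrm{diag}(\psi_1,\psi_2)$, realized by $A_\Psi=\mathrm{diag}(A_1,A_2)$, $B_\Psi=\mathrm{diag}(B_1,B_2)$, $C_\Psi=\mathrm{diag}(C_1,C_2)$, $D_\Psi=\mathrm{diag}(D_1,D_2)$, and $$J=\begin{pmatrix}I_{n_z}\\ I_{n_z}\end{pmatrix},\qquad T=\begin{pmatrix}I_{n_z}&-\beta^{-1}I_{n_z}\\ -\alpha I_{n_z}&I_{n_z}\end{pmatrix}.$$ $R$ is partitioned into $2\times 2$ blocks $R_{ij}$ conformably with $A_\Psi=\mathrm{diag}(A_1,A_2)$. Finite-horizon IQC: $\Delta$ satisfies a finite-horizon IQC with terminal cost matrix $Z=Z^T$ with respect to $\Pi=[\Psi T]^*M[\Psi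 T]$ if, for every $z\in L_{2e}^{n_z}$, the trajectories of the filter $\dot\xi=A_\Psi\xi+B_\Psi Tu$, $\xi(0)=0$, $y=C_\Psi\xi+D_\Psi Tu$ driven by $u=\mathrm{col}(z,\Delta(z))$ satisfy $\int_0^{\theta}y(t)^TMy(t)\,dt+\xi(\theta)^TZ\xi(\theta)\ge0$ for all $\theta>0$. *)

theory Defs
  imports
    "HOL-Analysis.Analysis"
    "HOL-Computational_Algebra.Fraction_Field"
    "Jordan_Normal_Form.Matrix"
begin

text \<open>
  Vectors and matrices are those of \<^theory>\<open>Jordan_Normal_Form.Matrix\<close>: their dimensions are natural
  numbers, so minimal realizations can be compared by their order, and a realization may have order
  zero (static transfer matrices). The identically named notions and notations of the
  type-indexed vectors are switched off.
\<close>

unbundle no vec_syntax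
unbundle no inner_syntax
hide_type (open) Finite_Cartesian_Product.vec
hide_const (open) Finite_Cartesian_Product.vec Finite_Cartesian_Product.mat

subsection \<open>Definiteness and block matrices\<close>

definition pos_def_mat :: "real mat \<Rightarrow> bool" where
  "pos_def_mat Q \<longleftrightarrow> transpose_mat Q = Q \<and>
     (\<forall>x \<in> carrier_vec (dim_row Q). x \<noteq> 0\<^sub>v (dim_row Q) \<longrightarrow> x \<bullet> (Q *\<^sub>v x) > 0)"

definition neg_def_mat :: "real mat \<Rightarrow> bool" where
  "neg_def_mat Q \<longleftrightarrow> pos_def_mat (- Q)"

definition anti_diag_sym :: "real mat \<Rightarrow> real mat" where
  "anti_diag_sym X = four_block_mat
     (0\<^sub>m (dim_row X) (dim_row X)) X
     (transpose_mat X) (0\<^sub>m (dim_col X) (dim_col X))"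

definition J_mat :: "nat \<Rightarrow> real mat" where
  "J_mat nz = 1\<^sub>m nz @\<^sub>r 1\<^sub>m nz"

definition T_mat :: "real \<Rightarrow> real \<Rightarrow> nat \<Rightarrow> real mat" where
  "T_mat \<alpha> \<beta> nz = four_block_mat
     (1\<^sub>m nz) ((- inverse \<beta>) \<cdot>\<^sub>m 1\<^sub>m nz)
     ((- \<alpha>) \<cdot>\<^sub>m 1\<^sub>m nz) (1\<^sub>m nz)"

subsection \<open>Real rational transfer matrices and minimal realizations\<close>

text \<open>
  A real rational matrix has entries in the field of fractions of the real polynomials in \<open>s\<close>.
\<close>

definition stable_proper :: "real poly fract mat \<Rightarrow> bool" where
  "stable_proper \<psi> \<longleftrightarrow> (\<forall>i < dim_row \<psi>. \<forall>j < dim_col \<psi>. \<exists>p q.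
     \<psi> $$ (i, j) = Fract p q \<and> q \<noteq> 0 \<and> degree p \<le> degree q \<and>
     (\<forall>s :: complex. poly (map_poly complex_of_real q) s = 0 \<longrightarrow> Re s < 0))"

definition const_fract :: "real \<Rightarrow> real poly fract" where
  "const_fract c = Fract [:c:] 1"

definition s_fract :: "real poly fract" where
  "s_fract = Fract [:0, 1:] 1"

text \<open>
  \<open>(A, B, C, D)\<close> with \<open>n\<close> states realizes \<open>\<psi>\<close>: the matrix \<open>V\<close> is the resolvent \<open>(s I - A)\<^sup>-\<^sup>1\<close>,
  formed over the field of rational functions.
\<close>

definition realization ::
  "real poly fract mat \<Rightarrow> nat \<Rightarrow> real mat \<Rightarrow> real mat \<Rightarrow> real mat \<Rightarrow> real mat \<Rightarrow> bool" where
  "realization \<psi> n A B C D \<longleftrightarrow>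
     A \<in> carrier_mat n n \<and> B \<in> carrier_mat n (dim_col \<psi>) \<and>
     C \<in> carrier_mat (dim_row \<psi>) n \<and> D \<in> carrier_mat (dim_row \<psi>) (dim_col \<psi>) \<and>
     (\<exists>V \<in> carrier_mat n n.
        inverts_mat (s_fract \<cdot>\<^sub>m 1\<^sub>m n - map_mat const_fract A) V \<and>
        inverts_mat V (s_fract \<cdot>\<^sub>m 1\<^sub>m n - map_mat const_fract A) \<and>
        \<psi> = map_mat const_fract C * V * map_mat const_fract B + map_mat const_fract D)"

definition minimal_realization ::
  "real poly fract mat \<Rightarrow> nat \<Rightarrow> real mat \<Rightarrow> real mat \<Rightarrow> real mat \<Rightarrow> real mat \<Rightarrow> bool" where
  "minimal_realization \<psi> n A B C D \<longleftrightarrow> realization \<psi> n A B C D \<and>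
     (\<forall>n' A' B' C' D'. realization \<psi> n' A' B' C' D' \<longrightarrow> n \<le> n')"

subsection \<open>Signals and operators\<close>

text \<open>
  Signals live on \<open>[0,\<infinity>)\<close>; here they are functions on all reals whose values at negative times are
  irrelevant.
\<close>

definition L2e :: "nat \<Rightarrow> (real \<Rightarrow> real vec) set" where
  "L2e n = {z. (\<forall>t\<ge>0. z t \<in> carrier_vec n) \<and>
     (\<forall>i<n. set_borel_measurable lebesgue {0..} (\<lambda>t. z t $ i)) \<and>
     (\<forall>\<theta>\<ge>0. set_integrable lebesgue {0..\<theta>} (\<lambda>t. z t \<bullet> z t))}"

definition mult_ops ::
  "real \<Rightarrow> real \<Rightarrow> nat \<Rightarrow> ((real \<Rightarrow> real vec) \<Rightarrow> (real \<Rightarrow> real vec)) set" where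
  "mult_ops \<alpha> \<beta> nz = {\<Delta>. \<exists>\<delta> \<in> {\<alpha>..\<beta>}. \<forall>z \<in> L2e nz. \<forall>t\<ge>0. \<Delta> z t = \<delta> \<cdot>\<^sub>v z t}"

subsection \<open>Finite-horizon IQC with terminal cost\<close>

text \<open>
  The trajectories of \<open>\<xi>' = A \<xi> + B u\<close>, \<open>\<xi>(0) = 0\<close>, \<open>y = C \<xi> + D u\<close> for a locally square integrable
  input are understood in the sense of Caratheodory, i.e. \<open>\<xi>\<close> is the integral of a locally
  integrable right-hand side; it is then locally absolutely continuous.
\<close>

definition filter_trajectory ::
  "real mat \<Rightarrow> real mat \<Rightarrow> real mat \<Rightarrow> real mat \<Rightarrow>
   (real \<Rightarrow> real vec) \<Rightarrow> (real \<Rightarrow> real vec) \<Rightarrow> (real \<Rightarrow> real vec) \<Rightarrow> bool" where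
  "filter_trajectory A B C D u \<xi> y \<longleftrightarrow>
     \<xi> 0 = 0\<^sub>v (dim_row A) \<and>
     (\<forall>t\<ge>0. \<xi> t \<in> carrier_vec (dim_row A)) \<and>
     (\<forall>t\<ge>0. \<forall>i < dim_row A.
        set_integrable lebesgue {0..t} (\<lambda>s. (A *\<^sub>v \<xi> s + B *\<^sub>v u s) $ i) \<and>
        \<xi> t $ i = (LINT s:{0..t}|lebesgue. (A *\<^sub>v \<xi> s + B *\<^sub>v u s) $ i)) \<and>
     (\<forall>t\<ge>0. y t = C *\<^sub>v \<xi> t + D *\<^sub>v u t)"

text \<open>
  The multiplier \<open>\<Pi> = [\<Psi> T]\<^sup>* M [\<Psi> T]\<close> enters only through its factorization, that is, through the
  realization \<open>(A, B, C, D)\<close> of \<open>\<Psi>\<close>, the matrix \<open>T\<close> and the matrix \<open>M\<close>.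
\<close>

definition finite_horizon_IQC ::
  "nat \<Rightarrow> real mat \<Rightarrow> real mat \<Rightarrow> real mat \<Rightarrow> real mat \<Rightarrow> real mat \<Rightarrow> real mat \<Rightarrow> real mat \<Rightarrow>
   ((real \<Rightarrow> real vec) \<Rightarrow> (real \<Rightarrow> real vec)) \<Rightarrow> bool" where
  "finite_horizon_IQC nz A B C D T M Z \<Delta> \<longleftrightarrow>
     transpose_mat Z = Z \<and>
     (\<forall>z \<in> L2e nz. \<forall>\<xi> y.
        filter_trajectory A (B * T) C (D * T) (\<lambda>t. z t @\<^sub>v \<Delta> z t) \<xi> y \<longrightarrow>
        (\<forall>\<theta>>0. (LINT t:{0..\<theta>}|lebesgue. y t \<bullet> (M *\<^sub>v y t)) + \<xi> \<theta> \<bullet> (Z *\<^sub>v \<xi> \<theta>) \<ge> 0))"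

end

theory Submission
  imports Defs
begin

text \<open>
  With \<open>a = 1 - \<delta>/\<beta> \<ge> 0\<close> and \<open>b = \<delta> - \<alpha> \<ge> 0\<close> the two filters are driven by \<open>a z\<close> and \<open>b z\<close>.
  If \<open>a, b > 0\<close>, the rescaled states \<open>\<xi>\<^sub>1/a\<close> and \<open>\<xi>\<^sub>2/b\<close> form a trajectory \<open>\<eta>\<close> of the filter with input
  \<open>J z\<close>. The first matrix inequality says that the supply rate plus the derivative of \<open>\<eta>\<^sup>T R \<eta>\<close> is
  nonnegative along it; integrating and bounding \<open>\<eta>(\<theta>)\<^sup>T R \<eta>(\<theta>)\<close> by the second inequality gives the
  claim for \<open>\<eta>\<close>. Since \<open>M\<close> and the terminal cost matrix have zero diagonal blocks, both
  terms of the IQC for \<open>\<xi>\<close> are \<open>a b\<close> times those for \<open>\<eta>\<close>. If \<open>a = 0\<close> or \<open>b = 0\<close>, then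
  one filter stays at rest and both terms vanish.
\<close>

subsection \<open>Indefinite Lebesgue integrals\<close>

text \<open>Fubini on the product of two copies of \<open>lebesgue\<close> requires this. A
  countable cover for \<open>lborel\<close> carries over, since completion keeps its sets measurable
  and their measure unchanged.\<close>

lemma sigma_finite_lebesgue: "sigma_finite_measure (lebesgue :: real measure)"
proof
  obtain A :: "real set set" where A: "countable A" "A \<subseteq> sets lborel" "\<Union>A = space lborel"
    "\<forall>a\<in>A. emeasure lborel a \<noteq> \<infinity>"
    using lborel.sigma_finite_countable by blast
  show "\<exists>A::real set set. countable A \<and> A \<subseteq> sets lebesgue \<and> \<Union>A = space lebesgue \<and>
      (\<forall>a\<in>A. emeasure lebesgue a \<noteq> \<infinity>)"
    using A by (intro exI[of _ A]) (auto simp: main_part_sets subset_iff)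
qed

text \<open>Encodes that \<open>F\<close> is locally absolutely continuous with derivative
  \<open>f\<close> almost everywhere, without differentiating anything. The initial condition
  \<open>F 0 = 0\<close> is built in, because the integral over \<open>{0..0}\<close>
  vanishes.\<close>

definition indef_integral :: "(real \<Rightarrow> real) \<Rightarrow> (real \<Rightarrow> real) \<Rightarrow> bool" where
  "indef_integral f F \<longleftrightarrow>
     (\<forall>t\<ge>0. set_integrable lebesgue {0..t} f \<and> F t = (LINT s:{0..t}|lebesgue. f s))"

lemma integrable_lebesgue_pair_mult:
  fixes f g :: "real \<Rightarrow> real"
  assumes f: "integrable lebesgue f" and g: "integrable lebesgue g"
  shows "integrable (lebesgue \<Otimes>\<^sub>M lebesgue) (\<lambda>(x, y). f x * g y)"
proof -
  interpret L: sigma_finite_measure "lebesgue :: real measure" by (rule sigma_finite_lebesgue)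
  interpret P: pair_sigma_finite "lebesgue :: real measure" "lebesgue :: real measure" ..
  note [measurable] = borel_measurable_integrable[OF f] borel_measurable_integrable[OF g]
  show ?thesis
    by (rule P.Fubini_integrable) (use f g in \<open>auto simp: abs_mult\<close>)
qed

text \<open>Both coordinates are Borel measurable on the product, so the triangle over which Fubini
  is applied below is measurable.\<close>

lemma measurable_le_pair_lebesgue [measurable]:
  "Measurable.pred (lebesgue \<Otimes>\<^sub>M lebesgue) (\<lambda>p::real \<times> real. fst p \<le> snd p)"
proof -
  have [measurable]: "(\<lambda>x::real. x) \<in> lebesgue \<rightarrow>\<^sub>M borel" by (simp add: measurable_completion)
  have 1: "(\<lambda>p::real\<times>real. fst p) \<in> lebesgue \<Otimes>\<^sub>M lebesgue \<rightarrow>\<^sub>M borel"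
     by (rule measurable_compose[OF measurable_fst]) measurable
  have 2: "(\<lambda>p::real\<times>real. snd p) \<in> lebesgue \<Otimes>\<^sub>M lebesgue \<rightarrow>\<^sub>M borel"
     by (rule measurable_compose[OF measurable_snd]) measurable
  show ?thesis using borel_measurable_le[OF 1 2] by (simp add: pred_def)
qed

text \<open>Fubini on the triangle \<open>x \<le> y\<close> of the square \<open>[0, \<theta>]\<^sup>2\<close>.\<close>

lemma indef_integral_by_parts:
  assumes F: "indef_integral f F" and G: "indef_integral g G" and "0 \<le> \<theta>"
  shows "set_integrable lebesgue {0..\<theta>} (\<lambda>t. F t * g t)"
    and "F \<theta> * G \<theta> =
      (LINT t:{0..\<theta>}|lebesgue. F t * g t) + (LINT t:{0..\<theta>}|lebesgue. G t * f t)"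
proof -
  interpret L: sigma_finite_measure "lebesgue :: real measure" by (rule sigma_finite_lebesgue)
  interpret P: pair_sigma_finite "lebesgue :: real measure" "lebesgue :: real measure" ..
  \<comment> \<open>Truncation to \<open>{0..\<theta>}\<close> turns local integrability into
    integrability on the whole line.\<close>
  define f' g' where "f' = (\<lambda>x. indicator {0..\<theta>} x * f x)" and "g' = (\<lambda>x. indicator {0..\<theta>} x * g x)"
  have f': "integrable lebesgue f'" and g': "integrable lebesgue g'"
    using F G \<open>0 \<le> \<theta>\<close> by (auto simp: f'_def g'_def indef_integral_def set_integrable_def)
  note fg = integrable_lebesgue_pair_mult[OF f' g']
  let ?h = "\<lambda>x y. f' x * g' y * of_bool (x \<le> y)"
  have [measurable]: "(\<lambda>(x, y). f' x * g' y) \<in> borel_measurable (lebesgue \<Otimes>\<^sub>M lebesgue)"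
    using fg by auto
  have h: "integrable (lebesgue \<Otimes>\<^sub>M lebesgue) (\<lambda>(x, y). ?h x y)"
  proof (rule Bochner_Integration.integrable_bound[OF fg])
    have "(\<lambda>p. (case p of (x, y) \<Rightarrow> f' x * g' y) * of_bool (fst p \<le> snd p))
       \<in> borel_measurable (lebesgue \<Otimes>\<^sub>M lebesgue)"
      by measurable
    then show "(\<lambda>(x, y). ?h x y) \<in> borel_measurable (lebesgue \<Otimes>\<^sub>M lebesgue)"
      by (simp add: case_prod_beta)
  qed (auto simp: abs_mult)
  \<comment> \<open>For fixed \<open>y\<close> the triangle leaves \<open>x\<close> in
    \<open>{0..y}\<close>, and the integral of \<open>f\<close> over it is
    \<open>F y\<close>.\<close>
  have inner: "(LINT x|lebesgue. ?h x y) = indicator {0..\<theta>} y * (F y * g y)" for y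
  proof (cases "y \<in> {0..\<theta>}")
    case True
    have "(LINT x|lebesgue. ?h x y) = (LINT x|lebesgue. (indicator {0..y} x * f x) * g' y)"
      using True by (intro Bochner_Integration.integral_cong) (auto simp: f'_def indicator_def)
    also have "\<dots> = F y * g y"
      using F True by (simp add: indef_integral_def set_lebesgue_integral_def g'_def)
    finally show ?thesis using True by simp
  qed (simp add: g'_def)
  show "set_integrable lebesgue {0..\<theta>} (\<lambda>t. F t * g t)"
    using P.integrable_snd[OF h] unfolding inner set_integrable_def by simp
  \<comment> \<open>For fixed \<open>x\<close> the variable \<open>y\<close> runs over
    \<open>{x..\<theta>}\<close>. This range is treated as the complement of \<open>{0..x}\<close>,
    whose contribution is \<open>G x\<close>.\<close>
  have inner': "(LINT y|lebesgue. ?h x y) = (LINT y|lebesgue. f' x * g' y) - indicator {0..\<theta>} x * (G x * f x)" for x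
  proof (cases "x \<in> {0..\<theta>}")
    case True
    have i: "integrable lebesgue (\<lambda>y. f' x * (indicator {0..x} y * g y))"
      using G True by (auto simp: indef_integral_def set_integrable_def)
    \<comment> \<open>The two ranges share the point \<open>y = x\<close>, so the integrands agree
      only off a null set.\<close>
    have "AE y in lebesgue. y \<noteq> x"
      by (rule AE_completion) (rule AE_lborel_singleton)
    then have "(LINT y|lebesgue. ?h x y) = (LINT y|lebesgue. f' x * g' y - f' x * (indicator {0..x} y * g y))"
    proof (intro integral_cong_AE)
      have "(\<lambda>y. ?h x y) = (\<lambda>y. f' x * g' y * indicator {x..} y)"
        by (auto simp: indicator_def)
      then show "(\<lambda>y. ?h x y) \<in> borel_measurable lebesgue"
        using borel_measurable_integrable[OF g']
        by (auto intro!: borel_measurable_times borel_measurable_indicator)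
    qed (use i g' True in \<open>auto simp: g'_def indicator_def elim!: AE_mp\<close>)
    also have "\<dots> = (LINT y|lebesgue. f' x * g' y) - f' x * (LINT y|lebesgue. indicator {0..x} y * g y)"
      using i g' by (subst Bochner_Integration.integral_diff) auto
    also have "(LINT y|lebesgue. indicator {0..x} y * g y) = G x"
      using G True by (simp add: indef_integral_def set_lebesgue_integral_def)
    finally show ?thesis using True by (simp add: f'_def)
  qed (simp add: f'_def)
  have int: "(LINT x|lebesgue. f' x) = F \<theta>" "(LINT x|lebesgue. g' x) = G \<theta>"
    using F G \<open>0 \<le> \<theta>\<close>
    by (simp_all add: f'_def g'_def indef_integral_def set_lebesgue_integral_def)
  \<comment> \<open>The double integral over the triangle is now evaluated in the other
    order.\<close>
  have "(LINT t:{0..\<theta>}|lebesgue. F t * g t) = (LINT x|lebesgue. LINT y|lebesgue. ?h x y)"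
    using P.Fubini_integral[OF h] unfolding inner by (simp add: set_lebesgue_integral_def)
  also have "\<dots> = (LINT x|lebesgue. f' x * G \<theta> - indicator {0..\<theta>} x * (G x * f x))"
    by (simp add: inner' int)
  also have "\<dots> = F \<theta> * G \<theta> - (LINT t:{0..\<theta>}|lebesgue. G t * f t)"
  proof (subst Bochner_Integration.integral_diff)
    \<comment> \<open>Integrability of \<open>G * f\<close> is read off from the slice identity
      \<open>inner'\<close>, whose other two terms are integrable.\<close>
    have "integrable lebesgue (\<lambda>x. f' x * G \<theta> - (LINT y|lebesgue. ?h x y))"
      using f' P.integrable_fst[OF h] by (intro Bochner_Integration.integrable_diff) auto
    then show "integrable lebesgue (\<lambda>x. indicator {0..\<theta>} x * (G x * f x))"
      by (simp add: inner' int)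
  qed (use f' in \<open>auto simp: int set_lebesgue_integral_def\<close>)
  finally show "F \<theta> * G \<theta> =
      (LINT t:{0..\<theta>}|lebesgue. F t * g t) + (LINT t:{0..\<theta>}|lebesgue. G t * f t)"
    by simp
qed

lemma indef_integral_bounded:
  assumes F: "indef_integral f F" and t: "t \<in> {0..\<theta>}"
  shows "\<bar>F t\<bar> \<le> (LINT s:{0..\<theta>}|lebesgue. \<bar>f s\<bar>)"
proof -
  have f: "set_integrable lebesgue {0..\<theta>} f" "set_integrable lebesgue {0..t} f"
    using F t by (auto simp: indef_integral_def)
  have "\<bar>F t\<bar> = \<bar>LINT s:{0..t}|lebesgue. f s\<bar>"
    using F t by (simp add: indef_integral_def)
  also have "\<dots> \<le> (LINT s:{0..t}|lebesgue. \<bar>f s\<bar>)"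
    using set_integral_norm_bound[OF f(2)] by simp
  also have "\<dots> \<le> (LINT s:{0..\<theta>}|lebesgue. \<bar>f s\<bar>)"
    using t set_integrable_abs[OF f(1)] set_integrable_abs[OF f(2)]
    unfolding set_lebesgue_integral_def set_integrable_def
    by (intro integral_mono) (auto simp: indicator_def)
  finally show ?thesis .
qed

text \<open>A by-product of integration by parts: against the constant 1 with primitive
  \<open>t\<close>, it makes \<open>F t * 1\<close> integrable on the interval, hence measurable
  there.\<close>

lemma indef_integral_measurable:
  assumes F: "indef_integral f F"
  shows "set_borel_measurable lebesgue {0..\<theta>} F"
proof (cases "0 \<le> \<theta>")
  case True
  have "indef_integral (\<lambda>_. 1) (\<lambda>t. t)"
    by (auto simp: indef_integral_def set_integrable_def set_lebesgue_integral_def)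
  from indef_integral_by_parts(1)[OF F this True] show ?thesis
    by (simp add: set_borel_measurable_def set_integrable_def)
qed (simp add: set_borel_measurable_def)

subsection \<open>Square-integrable signals\<close>

text \<open>Measurability is demanded separately because that of the square does not imply that of
  \<open>f\<close>.\<close>

definition square_integrable_on :: "(real \<Rightarrow> real) \<Rightarrow> real set \<Rightarrow> bool" where
  "square_integrable_on f S \<longleftrightarrow>
     set_borel_measurable lebesgue S f \<and> set_integrable lebesgue S (\<lambda>t. f t * f t)"

text \<open>The product is dominated by the sum of the squares, by expanding the squares of
  \<open>f t - g t\<close> and \<open>f t + g t\<close>.\<close>

lemma square_integrable_on_mult:
  assumes f: "square_integrable_on f S" and g: "square_integrable_on g S"
  shows "set_integrable lebesgue S (\<lambda>t. f t * g t)"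
proof (rule set_integrable_bound)
  show "set_integrable lebesgue S (\<lambda>t. f t * f t + g t * g t)"
    using f g by (auto simp: square_integrable_on_def)
  have "(\<lambda>t. (indicator S t *\<^sub>R f t) * (indicator S t *\<^sub>R g t)) \<in> borel_measurable lebesgue"
    using f g by (intro borel_measurable_times) (auto simp: square_integrable_on_def set_borel_measurable_def)
  also have "(\<lambda>t. (indicator S t *\<^sub>R f t) * (indicator S t *\<^sub>R g t)) = (\<lambda>t. indicator S t *\<^sub>R (f t * g t))"
    by (auto simp: indicator_def)
  finally show "set_borel_measurable lebesgue S (\<lambda>t. f t * g t)"
    by (simp add: set_borel_measurable_def)
  have "\<bar>f t * g t\<bar> \<le> f t * f t + g t * g t" for t
    using sum_squares_bound[of "f t" "g t"] sum_squares_bound[of "f t" "- g t"]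
      zero_le_square[of "f t"] zero_le_square[of "g t"]
    unfolding power2_eq_square abs_le_iff by auto
  then show "AE t in lebesgue. t \<in> S \<longrightarrow> norm (f t * g t) \<le> norm (f t * f t + g t * g t)"
    by (auto intro: order_trans)
qed

lemma square_integrable_on_add:
  assumes f: "square_integrable_on f S" and g: "square_integrable_on g S"
  shows "square_integrable_on (\<lambda>t. f t + g t) S"
proof -
  have "set_integrable lebesgue S (\<lambda>t. f t * f t + 2 * (f t * g t) + g t * g t)"
    using f g square_integrable_on_mult[OF f g]
    by (intro set_integral_add) (auto simp: square_integrable_on_def)
  moreover have "set_borel_measurable lebesgue S (\<lambda>t. f t + g t)"
    using f g by (auto simp: square_integrable_on_def set_borel_measurable_def distrib_left)
  ultimately show ?thesis
    by (simp add: square_integrable_on_def algebra_simps)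
qed

lemma square_integrable_on_cmult:
  assumes "square_integrable_on f S"
  shows "square_integrable_on (\<lambda>t. c * f t) S"
proof -
  have "set_integrable lebesgue S (\<lambda>t. (c * c) * (f t * f t))"
    using assms by (intro set_integrable_mult_right) (auto simp: square_integrable_on_def)
  moreover have "(\<lambda>t. c * (indicator S t *\<^sub>R f t)) \<in> borel_measurable lebesgue"
    using assms by (intro borel_measurable_times) (auto simp: square_integrable_on_def set_borel_measurable_def)
  ultimately show ?thesis
    by (simp add: square_integrable_on_def set_borel_measurable_def algebra_simps)
qed

lemma square_integrable_on_sum:
  assumes "\<And>i. i \<in> I \<Longrightarrow> square_integrable_on (f i) S"
  shows "square_integrable_on (\<lambda>t. \<Sum>i\<in>I. f i t) S"
proof (cases "finite I")
  case True
  then show ?thesis using assms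
    by (induction I) (auto simp: square_integrable_on_add, simp add: square_integrable_on_def set_borel_measurable_def set_integrable_def)
qed (simp add: square_integrable_on_def set_borel_measurable_def set_integrable_def)

lemma square_integrable_on_cong:
  assumes "\<And>t. t \<in> S \<Longrightarrow> f t = g t"
  shows "square_integrable_on f S \<longleftrightarrow> square_integrable_on g S"
proof -
  have "(\<lambda>t. indicator S t *\<^sub>R f t) = (\<lambda>t. indicator S t *\<^sub>R g t)"
    using assms by (auto simp: indicator_def)
  moreover have "(\<lambda>t. indicator S t *\<^sub>R (f t * f t)) = (\<lambda>t. indicator S t *\<^sub>R (g t * g t))"
    using assms by (auto simp: indicator_def)
  ultimately show ?thesis
    unfolding square_integrable_on_def set_borel_measurable_def set_integrable_def by simp
qed

text \<open>On a bounded interval \<open>F\<close> is measurable and bounded by the integral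
  \<open>?B\<close> of the absolute value of \<open>f\<close>. Filter states thereby become square
  integrable, as the output products require.\<close>

lemma indef_integral_square_integrable:
  assumes F: "indef_integral f F"
  shows "square_integrable_on F {0..\<theta>}"
proof -
  let ?B = "LINT s:{0..\<theta>}|lebesgue. \<bar>f s\<bar>"
  have meas: "set_borel_measurable lebesgue {0..\<theta>} F"
    by (rule indef_integral_measurable[OF F])
  have "set_integrable lebesgue {0..\<theta>} (\<lambda>t. F t * F t)"
  proof (rule set_integrable_bound)
    show "set_integrable lebesgue {0..\<theta>} (\<lambda>t. ?B * ?B)"
      by (cases "0 \<le> \<theta>") (auto simp: set_integrable_def)
    have "(\<lambda>t. (indicator {0..\<theta>} t *\<^sub>R F t) * (indicator {0..\<theta>} t *\<^sub>R F t)) \<in> borel_measurable lebesgue"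
      using meas by (intro borel_measurable_times) (auto simp: set_borel_measurable_def)
    also have "(\<lambda>t. (indicator {0..\<theta>} t *\<^sub>R F t) * (indicator {0..\<theta>} t *\<^sub>R F t)) =
        (\<lambda>t. indicator {0..\<theta>} t *\<^sub>R (F t * F t))"
      by (auto simp: indicator_def)
    finally show "set_borel_measurable lebesgue {0..\<theta>} (\<lambda>t. F t * F t)"
      by (simp add: set_borel_measurable_def)
    have "\<bar>F t\<bar> * \<bar>F t\<bar> \<le> ?B * ?B" if "t \<in> {0..\<theta>}" for t
      using indef_integral_bounded[OF F that] by (intro mult_mono) auto
    then show "AE t in lebesgue. t \<in> {0..\<theta>} \<longrightarrow> norm (F t * F t) \<le> norm (?B * ?B)"
      by (auto simp: abs_mult)
  qed
  with meas show ?thesis by (simp add: square_integrable_on_def)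
qed

lemma indef_integral_cmult:
  assumes "indef_integral f F"
  shows "indef_integral (\<lambda>t. c * f t) (\<lambda>t. c * F t)"
  using assms by (auto simp: indef_integral_def)

lemma indef_integral_cong:
  assumes "\<And>t. 0 \<le> t \<Longrightarrow> f t = f' t" and "\<And>t. 0 \<le> t \<Longrightarrow> F t = F' t"
  shows "indef_integral f F \<longleftrightarrow> indef_integral f' F'"
proof -
  have "set_integrable lebesgue {0..t} f \<longleftrightarrow> set_integrable lebesgue {0..t} f'" for t
    using assms by (intro set_integrable_cong) auto
  moreover have "(LINT s:{0..t}|lebesgue. f s) = (LINT s:{0..t}|lebesgue. f' s)" for t
    using assms by (intro set_lebesgue_integral_cong) auto
  ultimately show ?thesis using assms unfolding indef_integral_def by auto
qed

section \<open>Quadratic forms along vector-valued indefinite integrals\<close>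

lemma set_integrable_sum_fun:
  fixes f :: "'i \<Rightarrow> 'a \<Rightarrow> real"
  assumes "\<And>i. i \<in> I \<Longrightarrow> set_integrable M S (f i)"
  shows "set_integrable M S (\<lambda>t. \<Sum>i\<in>I. f i t)"
    and "(LINT t:S|M. \<Sum>i\<in>I. f i t) = (\<Sum>i\<in>I. LINT t:S|M. f i t)"
  using assms unfolding set_integrable_def set_lebesgue_integral_def scaleR_sum_right
  by (auto intro!: Bochner_Integration.integral_sum)

lemma scalar_prod_mult_mat_vec:
  fixes Q :: "real mat"
  assumes "Q \<in> carrier_mat n m" "u \<in> carrier_vec n" "v \<in> carrier_vec m"
  shows "u \<bullet> (Q *\<^sub>v v) = (\<Sum>i<n. \<Sum>j<m. Q $$ (i, j) * (u $ i * v $ j))"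
  using assms
  by (auto simp: scalar_prod_def sum_distrib_left lessThan_atLeast0 intro!: sum.cong)

text \<open>The integrated product rule for the quadratic form of \<open>Q\<close> along
  \<open>x' = g\<close>; no boundary term at time 0 appears because \<open>x\<close> vanishes there.
  Expanding into entries reduces it to scalar integration by parts.\<close>

lemma quadratic_form_indef_integral:
  fixes Q :: "real mat"
  assumes Q: "Q \<in> carrier_mat n n" and sym: "transpose_mat Q = Q"
    and x: "\<And>t. 0 \<le> t \<Longrightarrow> x t \<in> carrier_vec n" and g: "\<And>t. 0 \<le> t \<Longrightarrow> g t \<in> carrier_vec n"
    and ii: "\<And>i. i < n \<Longrightarrow> indef_integral (\<lambda>t. g t $ i) (\<lambda>t. x t $ i)" and "0 \<le> \<theta>"
  shows "set_integrable lebesgue {0..\<theta>} (\<lambda>t. x t \<bullet> (Q *\<^sub>v g t))" (is ?int)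
    and "x \<theta> \<bullet> (Q *\<^sub>v x \<theta>) = 2 * (LINT t:{0..\<theta>}|lebesgue. x t \<bullet> (Q *\<^sub>v g t))" (is ?eq)
proof -
  define I where "I i j = (LINT t:{0..\<theta>}|lebesgue. x t $ i * g t $ j)" for i j
  have int: "set_integrable lebesgue {0..\<theta>} (\<lambda>t. x t $ i * g t $ j)"
    and parts: "x \<theta> $ i * x \<theta> $ j = I i j + I j i" if "i < n" "j < n" for i j
    using indef_integral_by_parts[OF ii[OF that(1)] ii[OF that(2)] \<open>0 \<le> \<theta>\<close>] by (auto simp: I_def)
  have eq: "x t \<bullet> (Q *\<^sub>v g t) = (\<Sum>i<n. \<Sum>j<n. Q $$ (i, j) * (x t $ i * g t $ j))"
    if "t \<in> {0..\<theta>}" for t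
    using scalar_prod_mult_mat_vec[OF Q x g] that by auto
  have "?int \<longleftrightarrow> set_integrable lebesgue {0..\<theta>}
      (\<lambda>t. \<Sum>i<n. \<Sum>j<n. Q $$ (i, j) * (x t $ i * g t $ j))"
    using eq by (intro set_integrable_cong) auto
  then show ?int
    by (auto intro!: set_integrable_sum_fun int)
  have "(LINT t:{0..\<theta>}|lebesgue. x t \<bullet> (Q *\<^sub>v g t)) =
      (LINT t:{0..\<theta>}|lebesgue. \<Sum>i<n. \<Sum>j<n. Q $$ (i, j) * (x t $ i * g t $ j))"
    using eq by (intro set_lebesgue_integral_cong) auto
  also have "\<dots> = (\<Sum>i<n. LINT t:{0..\<theta>}|lebesgue. \<Sum>j<n. Q $$ (i, j) * (x t $ i * g t $ j))"
    by (rule set_integrable_sum_fun(2))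
      (auto intro!: set_integrable_sum_fun(1) set_integrable_mult_right int)
  also have "\<dots> = (\<Sum>i<n. \<Sum>j<n. LINT t:{0..\<theta>}|lebesgue. Q $$ (i, j) * (x t $ i * g t $ j))"
    by (intro sum.cong refl set_integrable_sum_fun(2)) (auto intro!: set_integrable_mult_right int)
  also have "\<dots> = (\<Sum>i<n. \<Sum>j<n. Q $$ (i, j) * I i j)"
    by (simp add: I_def)
  finally have J: "(LINT t:{0..\<theta>}|lebesgue. x t \<bullet> (Q *\<^sub>v g t)) = (\<Sum>i<n. \<Sum>j<n. Q $$ (i, j) * I i j)" .
  \<comment> \<open>Integration by parts yields \<open>I i j + I j i\<close> for each entry.
    Symmetry of \<open>Q\<close> makes the two resulting double sums equal, which gives the factor
    2.\<close>
  have Qsym: "Q $$ (j, i) = Q $$ (i, j)" if "i < n" "j < n" for i j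
    using arg_cong[OF sym, of "\<lambda>X. X $$ (i, j)"] that Q by simp
  have "x \<theta> \<bullet> (Q *\<^sub>v x \<theta>) = (\<Sum>i<n. \<Sum>j<n. Q $$ (i, j) * (x \<theta> $ i * x \<theta> $ j))"
    using scalar_prod_mult_mat_vec[OF Q x x] \<open>0 \<le> \<theta>\<close> by auto
  also have "\<dots> = (\<Sum>i<n. \<Sum>j<n. Q $$ (i, j) * I i j) + (\<Sum>i<n. \<Sum>j<n. Q $$ (i, j) * I j i)"
    by (simp add: parts algebra_simps sum.distrib)
  also have "(\<Sum>i<n. \<Sum>j<n. Q $$ (i, j) * I j i) = (\<Sum>i<n. \<Sum>j<n. Q $$ (i, j) * I i j)"
    by (subst sum.swap) (auto simp: Qsym intro!: sum.cong)
  finally show ?eq by (simp add: J)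
qed

section \<open>Square-integrable vector signals\<close>

definition vec_square_integrable_on :: "(real \<Rightarrow> real vec) \<Rightarrow> real set \<Rightarrow> nat \<Rightarrow> bool" where
  "vec_square_integrable_on v S n \<longleftrightarrow>
     (\<forall>t\<in>S. v t \<in> carrier_vec n) \<and> (\<forall>i<n. square_integrable_on (\<lambda>t. v t $ i) S)"

lemma vec_square_integrable_on_add:
  assumes "vec_square_integrable_on v S n" "vec_square_integrable_on w S n"
  shows "vec_square_integrable_on (\<lambda>t. v t + w t) S n"
  unfolding vec_square_integrable_on_def
proof (intro conjI allI impI)
  fix i assume "i < n"
  then have "square_integrable_on (\<lambda>t. v t $ i + w t $ i) S"
    using assms by (intro square_integrable_on_add) (auto simp: vec_square_integrable_on_def)
  also have "?this \<longleftrightarrow> square_integrable_on (\<lambda>t. (v t + w t) $ i) S"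
    using assms \<open>i < n\<close> by (intro square_integrable_on_cong) (auto simp: vec_square_integrable_on_def)
  finally show "square_integrable_on (\<lambda>t. (v t + w t) $ i) S" .
qed (use assms in \<open>auto simp: vec_square_integrable_on_def\<close>)

lemma vec_square_integrable_on_mult_mat:
  assumes Q: "Q \<in> carrier_mat m n" and v: "vec_square_integrable_on v S n"
  shows "vec_square_integrable_on (\<lambda>t. Q *\<^sub>v v t) S m"
  unfolding vec_square_integrable_on_def
proof (intro conjI allI impI)
  fix i assume "i < m"
  have "square_integrable_on (\<lambda>t. \<Sum>j<n. Q $$ (i, j) * v t $ j) S"
    using v by (intro square_integrable_on_sum square_integrable_on_cmult)
      (auto simp: vec_square_integrable_on_def)
  also have "?this \<longleftrightarrow> square_integrable_on (\<lambda>t. (Q *\<^sub>v v t) $ i) S"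
    using Q v \<open>i < m\<close> by (intro square_integrable_on_cong)
      (auto simp: vec_square_integrable_on_def scalar_prod_def lessThan_atLeast0 intro!: sum.cong)
  finally show "square_integrable_on (\<lambda>t. (Q *\<^sub>v v t) $ i) S" .
qed (use Q v in \<open>auto simp: vec_square_integrable_on_def intro!: mult_mat_vec_carrier\<close>)

lemma vec_square_integrable_on_scalar_prod:
  assumes v: "vec_square_integrable_on v S n" and w: "vec_square_integrable_on w S n"
  shows "set_integrable lebesgue S (\<lambda>t. v t \<bullet> w t)"
proof -
  have "set_integrable lebesgue S (\<lambda>t. \<Sum>i<n. v t $ i * w t $ i)"
    using v w by (intro set_integrable_sum_fun square_integrable_on_mult)
      (auto simp: vec_square_integrable_on_def)
  also have "?this \<longleftrightarrow> ?thesis"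
    using v w by (intro set_integrable_cong)
      (auto simp: vec_square_integrable_on_def scalar_prod_def lessThan_atLeast0 intro!: sum.cong)
  finally show ?thesis .
qed

text \<open>Each squared component is dominated by the scalar product of the signal with itself; its
  measurability on the half-line restricts to the interval.\<close>

lemma L2e_vec_square_integrable_on:
  assumes z: "z \<in> L2e n"
  shows "vec_square_integrable_on z {0..\<theta>} n"
  unfolding vec_square_integrable_on_def square_integrable_on_def
proof (intro conjI allI impI)
  have c: "z t \<in> carrier_vec n" if "t \<in> {0..\<theta>}" for t using z that by (auto simp: L2e_def)
  then show "\<forall>t\<in>{0..\<theta>}. z t \<in> carrier_vec n" by blast
  fix i assume "i < n"
  then have m: "(\<lambda>t. indicator {0..} t * z t $ i) \<in> borel_measurable lebesgue"
    using z by (simp add: L2e_def set_borel_measurable_def)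
  have "(\<lambda>t. indicator {0..\<theta>} t * (indicator {0..} t * z t $ i)) \<in> borel_measurable lebesgue"
    by (intro borel_measurable_times m borel_measurable_indicator) auto
  also have "(\<lambda>t. indicator {0..\<theta>} t * (indicator {0..} t * z t $ i)) = (\<lambda>t. indicator {0..\<theta>} t * z t $ i)"
    by (auto simp: indicator_def)
  finally have m1: "(\<lambda>t. indicator {0..\<theta>} t * z t $ i) \<in> borel_measurable lebesgue" .
  then show "set_borel_measurable lebesgue {0..\<theta>} (\<lambda>t. z t $ i)"
    by (simp add: set_borel_measurable_def)
  show "set_integrable lebesgue {0..\<theta>} (\<lambda>t. z t $ i * z t $ i)"
  proof (cases "0 \<le> \<theta>")
    case True
    show ?thesis
    proof (rule set_integrable_bound)
      show "set_integrable lebesgue {0..\<theta>} (\<lambda>t. z t \<bullet> z t)"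
        using z True by (simp add: L2e_def)
      have "(\<lambda>t. (indicator {0..\<theta>} t * z t $ i) * (indicator {0..\<theta>} t * z t $ i)) \<in> borel_measurable lebesgue"
        by (intro borel_measurable_times m1)
      also have "(\<lambda>t. (indicator {0..\<theta>} t * z t $ i) * (indicator {0..\<theta>} t * z t $ i)) =
          (\<lambda>t. indicator {0..\<theta>} t * (z t $ i * z t $ i))"
        by (auto simp: indicator_def)
      finally show "set_borel_measurable lebesgue {0..\<theta>} (\<lambda>t. z t $ i * z t $ i)"
        by (simp add: set_borel_measurable_def)
      have "z t $ i * z t $ i \<le> z t \<bullet> z t" if "t \<in> {0..\<theta>}" for t
        using c[OF that] \<open>i < n\<close> member_le_sum[of i "{0..<n}" "\<lambda>i. z t $ i * z t $ i"]
        by (auto simp: scalar_prod_def)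
      then show "AE t in lebesgue. t \<in> {0..\<theta>} \<longrightarrow> norm (z t $ i * z t $ i) \<le> norm (z t \<bullet> z t)"
        by (auto intro!: AE_I2 intro: order_trans[OF _ abs_ge_self])
    qed
  qed (simp add: set_integrable_def)
qed

subsection \<open>Linear systems with locally integrable inputs\<close>

text \<open>In the norm \<open>sup e\<^sup>-\<^sup>2\<^sup>c\<^sup>t \<bar>N t\<bar>\<close> the map \<open>N \<mapsto> c \<integral> N\<close> is a contraction with factor \<open>1/2\<close>.\<close>

lemma gronwall_zero:
  fixes N :: "real \<Rightarrow> real"
  assumes int: "set_integrable lebesgue {0..\<theta>} N" and "0 < c"
    and nonneg: "\<And>t. t \<in> {0..\<theta>} \<Longrightarrow> 0 \<le> N t"
    and le: "\<And>t. t \<in> {0..\<theta>} \<Longrightarrow> N t \<le> c * (LINT s:{0..t}|lebesgue. N s)"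
    and t: "t \<in> {0..\<theta>}"
  shows "N t = 0"
proof -
  have int_t: "set_integrable lebesgue {0..t} N" if "t \<in> {0..\<theta>}" for t
    using that by (intro set_integrable_subset[OF int]) auto
  \<comment> \<open>A uniform bound on \<open>N\<close>, so that the weighted supremum
    \<open>m\<close> is finite.\<close>
  have B: "N t \<le> c * (LINT s:{0..\<theta>}|lebesgue. N s)" if "t \<in> {0..\<theta>}" for t
  proof -
    have "(LINT s:{0..t}|lebesgue. N s) \<le> (LINT s:{0..\<theta>}|lebesgue. N s)"
      using int int_t[OF that] that nonneg unfolding set_integrable_def set_lebesgue_integral_def
      by (intro integral_mono) (auto simp: indicator_def)
    then show ?thesis using le[OF that] \<open>0 < c\<close> by (smt (verit) mult_left_mono)
  qed
  define m where "m = (SUP t\<in>{0..\<theta>}. exp (- (2 * c * t)) * N t)"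
  have bdd: "bdd_above ((\<lambda>t. exp (- (2 * c * t)) * N t) ` {0..\<theta>})"
  proof (rule bdd_aboveI2)
    fix t assume t: "t \<in> {0..\<theta>}"
    have "exp (- (2 * c * t)) * N t \<le> 1 * N t"
      using t nonneg[OF t] \<open>0 < c\<close> by (intro mult_right_mono) auto
    also have "\<dots> \<le> c * (LINT s:{0..\<theta>}|lebesgue. N s)" using B[OF t] by simp
    finally show "exp (- (2 * c * t)) * N t \<le> c * (LINT s:{0..\<theta>}|lebesgue. N s)" .
  qed
  have m: "exp (- (2 * c * t)) * N t \<le> m" if "t \<in> {0..\<theta>}" for t
    unfolding m_def by (rule cSUP_upper[OF that bdd])
  have Nm: "N t \<le> m * exp (2 * c * t)" if "t \<in> {0..\<theta>}" for t
    using m[OF that] by (simp add: exp_minus field_simps)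
  have "0 \<le> m" using m[OF t] nonneg[OF t] by (smt (verit) exp_gt_zero mult_nonneg_nonneg)
  \<comment> \<open>The contraction estimate: \<open>N\<close> is replaced under the integral by its
    bound \<open>m * exp (2 * c * s)\<close>, and integrating the exponential produces the factor
    \<open>1 / (2 * c)\<close>.\<close>
  have "exp (- (2 * c * t)) * N t \<le> m / 2" if t: "t \<in> {0..\<theta>}" for t
  proof -
    have hi: "((\<lambda>s. m * exp (2 * c * s)) has_integral
        (m / (2 * c) * exp (2 * c * t) - m / (2 * c) * exp (2 * c * 0))) {0..t}"
      using t \<open>0 < c\<close>
      by (intro fundamental_theorem_of_calculus)
        (auto intro!: derivative_eq_intros simp flip: has_real_derivative_iff_has_vector_derivative)
    have "N t \<le> c * integral {0..t} N"
      \<comment> \<open>Passing to the gauge integral makes the fundamental theorem of calculus in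
        \<open>hi\<close> applicable.\<close>
      using le[OF t] set_lebesgue_integral_eq_integral[OF int_t[OF t]] by simp
    also have "integral {0..t} N \<le> integral {0..t} (\<lambda>s. m * exp (2 * c * s))"
      using t hi by (intro integral_le set_lebesgue_integral_eq_integral[OF int_t[OF t]] Nm) auto
    also have "\<dots> = m / (2 * c) * exp (2 * c * t) - m / (2 * c)"
      using integral_unique[OF hi] by simp
    also have "c * \<dots> \<le> m / 2 * exp (2 * c * t)"
      using \<open>0 < c\<close> \<open>0 \<le> m\<close> by (simp add: field_simps)
    finally show ?thesis using \<open>0 < c\<close> by (simp add: exp_minus field_simps)
  qed
  then have "m \<le> m / 2"
    unfolding m_def using t by (intro cSUP_least) (auto simp: m_def)
  with \<open>0 \<le> m\<close> have "m = 0" by simp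
  with Nm[OF t] nonneg[OF t] show ?thesis by simp
qed

text \<open>Uniqueness for \<open>x' = A x\<close> with zero initial state: the sum norm
  \<open>N\<close> of the state is at most a constant times its own integral, so
  \<open>gronwall_zero\<close> applies. It settles the case of a filter with vanishing
  input.\<close>

lemma linear_homogeneous_zero:
  fixes A :: "real mat"
  assumes A: "A \<in> carrier_mat n n" and x: "\<And>t. 0 \<le> t \<Longrightarrow> x t \<in> carrier_vec n"
    and ii: "\<And>i. i < n \<Longrightarrow> indef_integral (\<lambda>t. (A *\<^sub>v x t) $ i) (\<lambda>t. x t $ i)" and "0 \<le> \<theta>"
  shows "x \<theta> = 0\<^sub>v n"
proof -
  define N where "N t = (\<Sum>i<n. \<bar>x t $ i\<bar>)" for t
  \<comment> \<open>The double sum is a crude bound for the operator norm of \<open>A\<close> in the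
    sum norm; adding 1 keeps \<open>c\<close> positive even for a zero or empty matrix.\<close>
  define c where "c = 1 + (\<Sum>i<n. \<Sum>j<n. \<bar>A $$ (i, j)\<bar>)"
  have "0 < c" unfolding c_def by (intro add_pos_nonneg sum_nonneg) auto
  \<comment> \<open>Integration by parts against this pair gives integrability of the components of
    \<open>x\<close>.\<close>
  have one: "indef_integral (\<lambda>_. 1) (\<lambda>t. t)"
    by (auto simp: indef_integral_def set_integrable_def set_lebesgue_integral_def)
  have int_x: "set_integrable lebesgue {0..t} (\<lambda>t. x t $ i)" if "0 \<le> t" "i < n" for t i
    using indef_integral_by_parts(1)[OF ii[OF that(2)] one that(1)] by simp
  have int_N: "set_integrable lebesgue {0..t} N" if "0 \<le> t" for t
    unfolding N_def using that by (intro set_integrable_sum_fun set_integrable_abs int_x) auto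
  have int_Ax: "set_integrable lebesgue {0..t} (\<lambda>t. (A *\<^sub>v x t) $ i)" if "0 \<le> t" "i < n" for t i
    using ii[OF that(2)] that(1) by (auto simp: indef_integral_def)
  have row: "\<bar>(A *\<^sub>v x s) $ i\<bar> \<le> (\<Sum>j<n. \<bar>A $$ (i, j)\<bar>) * N s" if "0 \<le> s" "i < n" for s i
  proof -
    have "\<bar>(A *\<^sub>v x s) $ i\<bar> = \<bar>\<Sum>j<n. A $$ (i, j) * x s $ j\<bar>"
      using A x[OF that(1)] that(2) by (auto simp: scalar_prod_def lessThan_atLeast0 intro!: sum.cong arg_cong[where f=abs])
    also have "\<dots> \<le> (\<Sum>j<n. \<bar>A $$ (i, j)\<bar> * \<bar>x s $ j\<bar>)"
      using sum_abs[of "\<lambda>j. A $$ (i, j) * x s $ j" "{..<n}"] by (simp add: abs_mult)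
    also have "\<dots> \<le> (\<Sum>j<n. \<bar>A $$ (i, j)\<bar> * N s)"
      unfolding N_def by (intro sum_mono mult_left_mono member_le_sum) auto
    finally show ?thesis by (simp add: sum_distrib_right)
  qed
  have le: "N t \<le> c * (LINT s:{0..t}|lebesgue. N s)" if t: "t \<in> {0..\<theta>}" for t
  proof -
    have "N t = (\<Sum>i<n. \<bar>LINT s:{0..t}|lebesgue. (A *\<^sub>v x s) $ i\<bar>)"
      unfolding N_def using ii t by (auto simp: indef_integral_def intro!: sum.cong)
    also have "\<dots> \<le> (\<Sum>i<n. LINT s:{0..t}|lebesgue. \<bar>(A *\<^sub>v x s) $ i\<bar>)"
      using set_integral_norm_bound[OF int_Ax] t by (intro sum_mono) auto
    also have "\<dots> \<le> (\<Sum>i<n. LINT s:{0..t}|lebesgue. (\<Sum>j<n. \<bar>A $$ (i, j)\<bar>) * N s)"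
      using t by (intro sum_mono set_integral_mono set_integrable_abs int_Ax set_integrable_mult_right int_N row) auto
    also have "\<dots> = (c - 1) * (LINT s:{0..t}|lebesgue. N s)"
      by (simp add: c_def flip: sum_distrib_right)
    also have "\<dots> \<le> c * (LINT s:{0..t}|lebesgue. N s)"
      by (intro mult_right_mono) (auto simp: set_lebesgue_integral_def N_def intro!: integral_nonneg_AE AE_I2 sum_nonneg)
    finally show ?thesis .
  qed
  have "N \<theta> = 0"
    using \<open>0 < c\<close> le \<open>0 \<le> \<theta>\<close> int_N
    by (intro gronwall_zero[of \<theta> N c]) (auto simp: N_def intro!: sum_nonneg)
  then show ?thesis
    using x[OF \<open>0 \<le> \<theta>\<close>] by (auto simp: N_def sum_nonneg_eq_0_iff intro!: eq_vecI)
qed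

text \<open>The state equation of a single filter started at rest; the zero initial state is part of
  \<open>indef_integral\<close>.\<close>

definition driven_by :: "nat \<Rightarrow> real mat \<Rightarrow> real mat \<Rightarrow> (real \<Rightarrow> real vec) \<Rightarrow> (real \<Rightarrow> real vec) \<Rightarrow> bool" where
  "driven_by n A B u x \<longleftrightarrow> (\<forall>t\<ge>0. x t \<in> carrier_vec n) \<and>
     (\<forall>i<n. indef_integral (\<lambda>t. (A *\<^sub>v x t + B *\<^sub>v u t) $ i) (\<lambda>t. x t $ i))"

lemma driven_by_vec_square_integrable_on:
  assumes "driven_by n A B u x"
  shows "vec_square_integrable_on x {0..\<theta>} n"
  using assms indef_integral_square_integrable
  by (fastforce simp: driven_by_def vec_square_integrable_on_def)

lemma driven_by_smult:
  assumes A: "A \<in> carrier_mat n n" and B: "B \<in> carrier_mat n m"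
    and u: "\<And>t. 0 \<le> t \<Longrightarrow> u t \<in> carrier_vec m" and x: "driven_by n A B u x"
  shows "driven_by n A B (\<lambda>t. c \<cdot>\<^sub>v u t) (\<lambda>t. c \<cdot>\<^sub>v x t)"
  unfolding driven_by_def
proof (intro conjI allI impI)
  have xc: "x t \<in> carrier_vec n" if "0 \<le> t" for t using x that by (simp add: driven_by_def)
  show "c \<cdot>\<^sub>v x t \<in> carrier_vec n" if "0 \<le> t" for t using xc[OF that] by simp
  fix i assume "i < n"
  have "indef_integral (\<lambda>t. c * (A *\<^sub>v x t + B *\<^sub>v u t) $ i) (\<lambda>t. c * x t $ i)"
    using x \<open>i < n\<close> by (intro indef_integral_cmult) (simp add: driven_by_def)
  also have "?this \<longleftrightarrow> indef_integral (\<lambda>t. (A *\<^sub>v (c \<cdot>\<^sub>v x t) + B *\<^sub>v (c \<cdot>\<^sub>v u t)) $ i) (\<lambda>t. (c \<cdot>\<^sub>v x t) $ i)"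
  proof (rule indef_integral_cong)
    fix t :: real assume t: "0 \<le> t"
    show "c * (A *\<^sub>v x t + B *\<^sub>v u t) $ i = (A *\<^sub>v (c \<cdot>\<^sub>v x t) + B *\<^sub>v (c \<cdot>\<^sub>v u t)) $ i"
      using A B xc[OF t] u[OF t] \<open>i < n\<close>
      by (simp add: mult_mat_vec[OF A xc[OF t]] mult_mat_vec[OF B u[OF t]] distrib_left del: index_mult_mat_vec)
    show "c * x t $ i = (c \<cdot>\<^sub>v x t) $ i"
      using xc[OF t] \<open>i < n\<close> by simp
  qed
  finally show "indef_integral (\<lambda>t. (A *\<^sub>v (c \<cdot>\<^sub>v x t) + B *\<^sub>v (c \<cdot>\<^sub>v u t)) $ i) (\<lambda>t. (c \<cdot>\<^sub>v x t) $ i)" .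
qed

text \<open>The zero input is written as a multiple of \<open>u\<close>, so that it matches a scaled
  input whose gain is 0.\<close>

lemma driven_by_zero:
  assumes A: "A \<in> carrier_mat n n" and B: "B \<in> carrier_mat n m"
    and u: "\<And>t. 0 \<le> t \<Longrightarrow> u t \<in> carrier_vec m" and x: "driven_by n A B (\<lambda>t. 0 \<cdot>\<^sub>v u t) x" and "0 \<le> \<theta>"
  shows "x \<theta> = 0\<^sub>v n"
proof (rule linear_homogeneous_zero[OF A])
  show xc: "x t \<in> carrier_vec n" if "0 \<le> t" for t using x that by (simp add: driven_by_def)
  fix i assume "i < n"
  have "(A *\<^sub>v x t + B *\<^sub>v (0 \<cdot>\<^sub>v u t)) $ i = (A *\<^sub>v x t) $ i" if "0 \<le> t" for t
    using A B xc[OF that] u[OF that] \<open>i < n\<close> by (simp add: mult_mat_vec[OF B u[OF that]] del: index_mult_mat_vec)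
  then have "indef_integral (\<lambda>t. (A *\<^sub>v x t + B *\<^sub>v (0 \<cdot>\<^sub>v u t)) $ i) (\<lambda>t. x t $ i) \<longleftrightarrow>
      indef_integral (\<lambda>t. (A *\<^sub>v x t) $ i) (\<lambda>t. x t $ i)"
    by (intro indef_integral_cong) auto
  then show "indef_integral (\<lambda>t. (A *\<^sub>v x t) $ i) (\<lambda>t. x t $ i)"
    using x \<open>i < n\<close> by (simp add: driven_by_def)
qed fact

subsection \<open>Dissipativity of a pair of filters\<close>

text \<open>The two matrix inequalities enter as the nonstrict scalar inequalities
  \<open>dissipation\<close> and \<open>terminal\<close>. The former evaluates the first one at a
  common input \<open>w\<close> of both filters, with a common factor 2 cancelled.\<close>

locale dissipative_filter_pair =
  fixes n1 n2 m1 m2 nz :: nat and A1 B1 C1 D1 A2 B2 C2 D2 P R K :: "real mat"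
  assumes A1: "A1 \<in> carrier_mat n1 n1" and B1: "B1 \<in> carrier_mat n1 nz"
    and C1: "C1 \<in> carrier_mat m1 n1" and D1: "D1 \<in> carrier_mat m1 nz"
    and A2: "A2 \<in> carrier_mat n2 n2" and B2: "B2 \<in> carrier_mat n2 nz"
    and C2: "C2 \<in> carrier_mat m2 n2" and D2: "D2 \<in> carrier_mat m2 nz"
    and P: "P \<in> carrier_mat m1 m2" and R: "R \<in> carrier_mat (n1 + n2) (n1 + n2)"
    and K: "K \<in> carrier_mat n1 n2" and R_sym: "transpose_mat R = R"
    and dissipation: "\<And>p q w. p \<in> carrier_vec n1 \<Longrightarrow> q \<in> carrier_vec n2 \<Longrightarrow> w \<in> carrier_vec nz \<Longrightarrow>
      0 \<le> (p @\<^sub>v q) \<bullet> (R *\<^sub>v ((A1 *\<^sub>v p + B1 *\<^sub>v w) @\<^sub>v (A2 *\<^sub>v q + B2 *\<^sub>v w)))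
        + (C1 *\<^sub>v p + D1 *\<^sub>v w) \<bullet> (P *\<^sub>v (C2 *\<^sub>v q + D2 *\<^sub>v w))"
    and terminal: "\<And>p q. p \<in> carrier_vec n1 \<Longrightarrow> q \<in> carrier_vec n2 \<Longrightarrow>
      (p @\<^sub>v q) \<bullet> (R *\<^sub>v (p @\<^sub>v q)) \<le> 2 * (p \<bullet> (K *\<^sub>v q))"
begin

text \<open>Integrating \<open>dissipation\<close> along the joint state turns its \<open>R\<close>
  term into half the quadratic form of \<open>R\<close> at time \<open>\<theta>\<close>, which
  \<open>terminal\<close> bounds by the \<open>K\<close> term.\<close>

lemma IQC_common_input:
  assumes z: "z \<in> L2e nz" and x1: "driven_by n1 A1 B1 z x1" and x2: "driven_by n2 A2 B2 z x2"
    and "0 \<le> \<theta>"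
  shows "0 \<le> (LINT t:{0..\<theta>}|lebesgue. (C1 *\<^sub>v x1 t + D1 *\<^sub>v z t) \<bullet> (P *\<^sub>v (C2 *\<^sub>v x2 t + D2 *\<^sub>v z t)))
    + x1 \<theta> \<bullet> (K *\<^sub>v x2 \<theta>)"
proof -
  let ?x = "\<lambda>t. x1 t @\<^sub>v x2 t"
  let ?g = "\<lambda>t. (A1 *\<^sub>v x1 t + B1 *\<^sub>v z t) @\<^sub>v (A2 *\<^sub>v x2 t + B2 *\<^sub>v z t)"
  let ?s = "\<lambda>t. (C1 *\<^sub>v x1 t + D1 *\<^sub>v z t) \<bullet> (P *\<^sub>v (C2 *\<^sub>v x2 t + D2 *\<^sub>v z t))"
  have zc: "z t \<in> carrier_vec nz" and x1c: "x1 t \<in> carrier_vec n1" and x2c: "x2 t \<in> carrier_vec n2"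
    if "0 \<le> t" for t using z x1 x2 that by (auto simp: L2e_def driven_by_def)
  have g: "?g t \<in> carrier_vec (n1 + n2)" if "0 \<le> t" for t
    using A1 A2 B1 B2 zc[OF that] x1c[OF that] x2c[OF that] by auto
  have ii: "indef_integral (\<lambda>t. ?g t $ i) (\<lambda>t. ?x t $ i)" if i: "i < n1 + n2" for i
  proof (cases "i < n1")
    case True
    have "?g t $ i = (A1 *\<^sub>v x1 t + B1 *\<^sub>v z t) $ i \<and> ?x t $ i = x1 t $ i" if "0 \<le> t" for t
      using True x1c[OF that] x2c[OF that] A1 B1 A2 B2 by auto
    then have "indef_integral (\<lambda>t. ?g t $ i) (\<lambda>t. ?x t $ i) \<longleftrightarrow>
        indef_integral (\<lambda>t. (A1 *\<^sub>v x1 t + B1 *\<^sub>v z t) $ i) (\<lambda>t. x1 t $ i)"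
      by (intro indef_integral_cong) blast+
    with True x1 show ?thesis by (simp add: driven_by_def)
  next
    case False
    have "?g t $ i = (A2 *\<^sub>v x2 t + B2 *\<^sub>v z t) $ (i - n1) \<and> ?x t $ i = x2 t $ (i - n1)" if "0 \<le> t" for t
      using False i x1c[OF that] x2c[OF that] A1 B1 A2 B2 by auto
    then have "indef_integral (\<lambda>t. ?g t $ i) (\<lambda>t. ?x t $ i) \<longleftrightarrow>
        indef_integral (\<lambda>t. (A2 *\<^sub>v x2 t + B2 *\<^sub>v z t) $ (i - n1)) (\<lambda>t. x2 t $ (i - n1))"
      by (intro indef_integral_cong) blast+
    with False i x2 show ?thesis by (simp add: driven_by_def)
  qed
  note ftc = quadratic_form_indef_integral[OF R R_sym _ g ii \<open>0 \<le> \<theta>\<close>]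
  have int_R: "set_integrable lebesgue {0..\<theta>} (\<lambda>t. ?x t \<bullet> (R *\<^sub>v ?g t))"
    and eq_R: "?x \<theta> \<bullet> (R *\<^sub>v ?x \<theta>) = 2 * (LINT t:{0..\<theta>}|lebesgue. ?x t \<bullet> (R *\<^sub>v ?g t))"
    by (intro ftc; use x1c x2c in auto)+
  \<comment> \<open>Both integrands must be integrable before the integral of their sum can be
    split; non-integrable functions have integral 0 by convention.\<close>
  have int_s: "set_integrable lebesgue {0..\<theta>} ?s"
    using L2e_vec_square_integrable_on[OF z] x1 x2
    by (intro vec_square_integrable_on_scalar_prod[where n=m1] vec_square_integrable_on_mult_mat[OF P]
        vec_square_integrable_on_add vec_square_integrable_on_mult_mat[OF C1] vec_square_integrable_on_mult_mat[OF D1]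
        vec_square_integrable_on_mult_mat[OF C2] vec_square_integrable_on_mult_mat[OF D2])
      (auto intro: driven_by_vec_square_integrable_on)
  have "0 \<le> (LINT t:{0..\<theta>}|lebesgue. ?x t \<bullet> (R *\<^sub>v ?g t) + ?s t)"
    unfolding set_lebesgue_integral_def
    using dissipation[OF x1c x2c zc] by (intro integral_nonneg_AE AE_I2) (auto simp: indicator_def)
  also have "\<dots> = (LINT t:{0..\<theta>}|lebesgue. ?x t \<bullet> (R *\<^sub>v ?g t)) + (LINT t:{0..\<theta>}|lebesgue. ?s t)"
    by (rule set_integral_add(2)[OF int_R int_s])
  finally show ?thesis
    using eq_R terminal[OF x1c x2c, OF \<open>0 \<le> \<theta>\<close> \<open>0 \<le> \<theta>\<close>] by linarith
qed

text \<open>Both terms are bilinear in the trajectories of the two filters, so separate gains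
  \<open>a\<close> and \<open>b\<close> multiply the whole expression by
  \<open>a * b\<close>.\<close>

lemma IQC_scaled_inputs:
  assumes z: "z \<in> L2e nz" and "0 \<le> a" "0 \<le> b" and x1: "driven_by n1 A1 B1 (\<lambda>t. a \<cdot>\<^sub>v z t) x1"
    and x2: "driven_by n2 A2 B2 (\<lambda>t. b \<cdot>\<^sub>v z t) x2" and "0 \<le> \<theta>"
  shows "0 \<le> (LINT t:{0..\<theta>}|lebesgue.
      (C1 *\<^sub>v x1 t + D1 *\<^sub>v (a \<cdot>\<^sub>v z t)) \<bullet> (P *\<^sub>v (C2 *\<^sub>v x2 t + D2 *\<^sub>v (b \<cdot>\<^sub>v z t))))
    + x1 \<theta> \<bullet> (K *\<^sub>v x2 \<theta>)" (is "0 \<le> (LINT t:_|_. ?y1 t \<bullet> (P *\<^sub>v ?y2 t)) + _")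
proof -
  have zc: "z t \<in> carrier_vec nz" and x1c: "x1 t \<in> carrier_vec n1" and x2c: "x2 t \<in> carrier_vec n2"
    if "0 \<le> t" for t using z x1 x2 that by (auto simp: L2e_def driven_by_def)
  have y1c: "?y1 t \<in> carrier_vec m1" and y2c: "?y2 t \<in> carrier_vec m2" if "0 \<le> t" for t
    using zc[OF that] x1c[OF that] x2c[OF that] C1 D1 C2 D2 by auto
  show ?thesis
  proof (cases "a = 0 \<or> b = 0")
    case True
    \<comment> \<open>Division by a zero gain is impossible; instead uniqueness keeps the filter
      with zero input at rest, and one factor of each product vanishes.\<close>
    have "x1 t \<bullet> (K *\<^sub>v x2 t) = 0 \<and> ?y1 t \<bullet> (P *\<^sub>v ?y2 t) = 0" if t: "0 \<le> t" for t
    proof (cases "a = 0")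
      case a: True
      have "x1 t = 0\<^sub>v n1"
        using driven_by_zero[OF A1 B1 zc x1[unfolded a] t] .
      moreover from this have "?y1 t = 0\<^sub>v m1"
        using a zc[OF t] C1 D1 by (auto simp: mult_mat_vec[OF D1 zc[OF t]] intro!: eq_vecI)
      ultimately show ?thesis
        using K P x2c[OF t] y2c[OF t] by (metis mult_mat_vec_carrier scalar_prod_left_zero)
    next
      case False
      with True have b: "b = 0" by simp
      have "x2 t = 0\<^sub>v n2"
        using driven_by_zero[OF A2 B2 zc x2[unfolded b] t] .
      moreover from this have "?y2 t = 0\<^sub>v m2"
        using b zc[OF t] C2 D2 by (auto simp: mult_mat_vec[OF D2 zc[OF t]] intro!: eq_vecI)
      moreover have "K *\<^sub>v 0\<^sub>v n2 = 0\<^sub>v n1" "P *\<^sub>v 0\<^sub>v m2 = 0\<^sub>v m1" using K P by auto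
      ultimately show ?thesis
        using x1c[OF t] y1c[OF t] by (metis scalar_prod_right_zero)
    qed
    note zero = this
    have "(LINT t:{0..\<theta>}|lebesgue. ?y1 t \<bullet> (P *\<^sub>v ?y2 t)) = (LINT t:{0..\<theta>}|lebesgue. 0)"
      using zero by (intro set_lebesgue_integral_cong) auto
    then show ?thesis using zero[OF \<open>0 \<le> \<theta>\<close>] by simp
  next
    case False
    with \<open>0 \<le> a\<close> \<open>0 \<le> b\<close> have ab: "0 < a" "0 < b" by auto
    \<comment> \<open>Dividing each state by its gain gives trajectories with the common input
      \<open>z\<close>.\<close>
    define h1 h2 where "h1 = (\<lambda>t. inverse a \<cdot>\<^sub>v x1 t)" and "h2 = (\<lambda>t. inverse b \<cdot>\<^sub>v x2 t)"
    have "driven_by n1 A1 B1 (\<lambda>t. inverse a \<cdot>\<^sub>v (a \<cdot>\<^sub>v z t)) h1"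
      unfolding h1_def by (rule driven_by_smult[OF A1 B1 _ x1]) (simp add: zc)
    then have h1: "driven_by n1 A1 B1 z h1"
      using ab by (simp add: smult_smult_assoc)
    have "driven_by n2 A2 B2 (\<lambda>t. inverse b \<cdot>\<^sub>v (b \<cdot>\<^sub>v z t)) h2"
      unfolding h2_def by (rule driven_by_smult[OF A2 B2 _ x2]) (simp add: zc)
    then have h2: "driven_by n2 A2 B2 z h2"
      using ab by (simp add: smult_smult_assoc)
    have h1c: "h1 t \<in> carrier_vec n1" and h2c: "h2 t \<in> carrier_vec n2" if "0 \<le> t" for t
      using x1c[OF that] x2c[OF that] by (auto simp: h1_def h2_def)
    have xh: "x1 t = a \<cdot>\<^sub>v h1 t" "x2 t = b \<cdot>\<^sub>v h2 t" for t
      using ab by (simp_all add: h1_def h2_def smult_smult_assoc)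
    let ?w1 = "\<lambda>t. C1 *\<^sub>v h1 t + D1 *\<^sub>v z t" and ?w2 = "\<lambda>t. C2 *\<^sub>v h2 t + D2 *\<^sub>v z t"
    have y: "?y1 t \<bullet> (P *\<^sub>v ?y2 t) = (a * b) * (?w1 t \<bullet> (P *\<^sub>v ?w2 t))" if t: "0 \<le> t" for t
    proof -
      have w: "?w1 t \<in> carrier_vec m1" "?w2 t \<in> carrier_vec m2"
        using zc[OF t] h1c[OF t] h2c[OF t] C1 D1 C2 D2 by auto
      have "?y1 t = a \<cdot>\<^sub>v ?w1 t"
        using zc[OF t] h1c[OF t] C1 D1
        by (simp add: xh mult_mat_vec[OF C1 h1c[OF t]] mult_mat_vec[OF D1 zc[OF t]]
            smult_add_distrib_vec[of _ m1])
      moreover have "?y2 t = b \<cdot>\<^sub>v ?w2 t"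
        using zc[OF t] h2c[OF t] C2 D2
        by (simp add: xh mult_mat_vec[OF C2 h2c[OF t]] mult_mat_vec[OF D2 zc[OF t]]
            smult_add_distrib_vec[of _ m2])
      ultimately show ?thesis
        using w P by (simp add: mult_mat_vec[OF P w(2)])
    qed
    have "x1 \<theta> \<bullet> (K *\<^sub>v x2 \<theta>) = (a * b) * (h1 \<theta> \<bullet> (K *\<^sub>v h2 \<theta>))"
      using K h1c[OF \<open>0 \<le> \<theta>\<close>] h2c[OF \<open>0 \<le> \<theta>\<close>]
      by (simp add: xh mult_mat_vec[OF K h2c[OF \<open>0 \<le> \<theta>\<close>]])
    moreover have "(LINT t:{0..\<theta>}|lebesgue. ?y1 t \<bullet> (P *\<^sub>v ?y2 t)) =
        (LINT t:{0..\<theta>}|lebesgue. (a * b) * (?w1 t \<bullet> (P *\<^sub>v ?w2 t)))"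
      using y by (intro set_lebesgue_integral_cong) auto
    ultimately have "(LINT t:{0..\<theta>}|lebesgue. ?y1 t \<bullet> (P *\<^sub>v ?y2 t)) + x1 \<theta> \<bullet> (K *\<^sub>v x2 \<theta>) =
        (a * b) * ((LINT t:{0..\<theta>}|lebesgue. ?w1 t \<bullet> (P *\<^sub>v ?w2 t)) + h1 \<theta> \<bullet> (K *\<^sub>v h2 \<theta>))"
      by (simp add: distrib_left)
    then show ?thesis
      using IQC_common_input[OF z h1 h2 \<open>0 \<le> \<theta>\<close>] ab by simp
  qed
qed

end

subsection \<open>Block matrices\<close>

lemma diag_block_mat_two_mult_vec:
  assumes "A \<in> carrier_mat r1 c1" "D \<in> carrier_mat r2 c2" "u \<in> carrier_vec c1" "v \<in> carrier_vec c2"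
  shows "diag_block_mat [A, D] *\<^sub>v (u @\<^sub>v v) = (A *\<^sub>v u) @\<^sub>v (D *\<^sub>v (v :: real vec))"
proof -
  have "diag_block_mat [A, D] = four_block_mat A (0\<^sub>m r1 c2) (0\<^sub>m r2 c1) D"
    unfolding diag_block_mat.simps(2)[of A "[D]"] Let_def diag_block_mat_singleton using assms by simp
  moreover have "four_block_mat A (0\<^sub>m r1 c2) (0\<^sub>m r2 c1) D *\<^sub>v (u @\<^sub>v v) =
      (A *\<^sub>v u + 0\<^sub>m r1 c2 *\<^sub>v v) @\<^sub>v (0\<^sub>m r2 c1 *\<^sub>v u + D *\<^sub>v v)"
    by (rule four_block_mat_mult_vec[OF assms(1) zero_carrier_mat zero_carrier_mat assms(2-4)])
  moreover have "A *\<^sub>v u + 0\<^sub>m r1 c2 *\<^sub>v v = A *\<^sub>v u" "0\<^sub>m r2 c1 *\<^sub>v u + D *\<^sub>v v = D *\<^sub>v v"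
    using assms by auto
  ultimately show ?thesis by metis
qed

lemma diag_block_mat_two_carrier:
  assumes "A \<in> carrier_mat r1 c1" "D \<in> carrier_mat r2 c2"
  shows "diag_block_mat [A, D] \<in> carrier_mat (r1 + r2) (c1 + c2)"
  using assms by (auto simp: dim_diag_block_mat intro!: carrier_matI)

lemma J_mat_carrier: "J_mat n \<in> carrier_mat (n + n) n"
  by (auto simp: J_mat_def)

lemma J_mat_mult_vec:
  assumes "w \<in> carrier_vec n"
  shows "J_mat n *\<^sub>v w = w @\<^sub>v w"
  unfolding J_mat_def using assms by (simp add: mat_mult_append[of _ n n _ n])

lemma T_mat_carrier: "T_mat \<alpha> \<beta> n \<in> carrier_mat (n + n) (n + n)"
  by (auto simp: T_mat_def)

text \<open>This identifies the gains of the two filters. For \<open>\<beta> > 0\<close> and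
  \<open>\<delta>\<close> in \<open>{\<alpha>..\<beta>}\<close> both are nonnegative, one vanishing
  at \<open>\<delta> = \<beta>\<close>, the other at \<open>\<delta> = \<alpha>\<close>.\<close>

lemma T_mat_mult_vec:
  assumes w: "w \<in> carrier_vec n"
  shows "T_mat \<alpha> \<beta> n *\<^sub>v (w @\<^sub>v \<delta> \<cdot>\<^sub>v w) = ((1 - \<delta> / \<beta>) \<cdot>\<^sub>v w) @\<^sub>v ((\<delta> - \<alpha>) \<cdot>\<^sub>v w)"
proof -
  have smult: "(c \<cdot>\<^sub>m 1\<^sub>m n) *\<^sub>v v = c \<cdot>\<^sub>v v" if "v \<in> carrier_vec n" for c :: real and v
    using that by (intro eq_vecI) auto
  have "T_mat \<alpha> \<beta> n *\<^sub>v (w @\<^sub>v \<delta> \<cdot>\<^sub>v w) =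
      (w + (- inverse \<beta>) \<cdot>\<^sub>v (\<delta> \<cdot>\<^sub>v w)) @\<^sub>v ((- \<alpha>) \<cdot>\<^sub>v w + \<delta> \<cdot>\<^sub>v w)"
    unfolding T_mat_def using w
    by (subst four_block_mat_mult_vec[of _ n n _ n _ n]) (auto simp: smult)
  also have "\<dots> = ((1 - \<delta> / \<beta>) \<cdot>\<^sub>v w) @\<^sub>v ((\<delta> - \<alpha>) \<cdot>\<^sub>v w)"
    using w by (intro arg_cong2[where f=append_vec] eq_vecI) (auto simp: divide_inverse algebra_simps)
  finally show ?thesis .
qed

lemma scalar_prod_transpose_mult_vec:
  fixes X :: "real mat"
  assumes X: "X \<in> carrier_mat n m" and q: "q \<in> carrier_vec m" and p: "p \<in> carrier_vec n"
  shows "q \<bullet> (transpose_mat X *\<^sub>v p) = (X *\<^sub>v q) \<bullet> p"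
proof -
  have "transpose_mat X *\<^sub>v p \<in> carrier_vec m" and "X *\<^sub>v q \<in> carrier_vec n"
    using X p q by auto
  then show ?thesis
    using transpose_vec_mult_scalar[OF X q p] comm_scalar_prod[of q m "transpose_mat X *\<^sub>v p"]
      comm_scalar_prod[of p n "X *\<^sub>v q"] q p by simp
qed

lemma anti_diag_sym_carrier:
  assumes "X \<in> carrier_mat n m"
  shows "anti_diag_sym X \<in> carrier_mat (n + m) (n + m)"
  using assms by (auto simp: anti_diag_sym_def)

lemma anti_diag_sym_transpose: "transpose_mat (anti_diag_sym X) = anti_diag_sym X"
  unfolding anti_diag_sym_def
  by (subst transpose_four_block_mat[of _ "dim_row X" "dim_row X" _ "dim_col X" _ "dim_col X"]) auto

lemma anti_diag_sym_mult_vec: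
  assumes X: "X \<in> carrier_mat n m" and p: "p \<in> carrier_vec n" and q: "q \<in> carrier_vec m"
  shows "anti_diag_sym X *\<^sub>v (p @\<^sub>v q) = (X *\<^sub>v q) @\<^sub>v (transpose_mat X *\<^sub>v p)"
  unfolding anti_diag_sym_def using assms
  by (subst four_block_mat_mult_vec[of _ n n _ m _ m]) auto

text \<open>The zero diagonal blocks leave two cross terms, which agree by transposition. The form
  is thus bilinear in \<open>p\<close> and \<open>q\<close>, so the two filters can be scaled
  independently.\<close>

lemma anti_diag_sym_quadratic_form:
  assumes X: "X \<in> carrier_mat n m" and p: "p \<in> carrier_vec n" and q: "q \<in> carrier_vec m"
  shows "(p @\<^sub>v q) \<bullet> (anti_diag_sym X *\<^sub>v (p @\<^sub>v q)) = 2 * (p \<bullet> (X *\<^sub>v q))"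
proof -
  have "q \<bullet> (transpose_mat X *\<^sub>v p) = p \<bullet> (X *\<^sub>v q)"
    using scalar_prod_transpose_mult_vec[OF X q p] comm_scalar_prod[OF mult_mat_vec_carrier[OF X q] p]
    by simp
  then show ?thesis
    using assms by (simp add: anti_diag_sym_mult_vec[OF X p q] scalar_prod_append[of _ n _ m])
qed

section \<open>From matrix inequalities to scalar inequalities\<close>

lemma pos_def_mat_nonneg:
  assumes Q: "pos_def_mat Q" and x: "x \<in> carrier_vec (dim_row Q)"
  shows "0 \<le> x \<bullet> (Q *\<^sub>v x)"
proof (cases "x = 0\<^sub>v (dim_row Q)")
  case True
  have "Q *\<^sub>v x \<in> carrier_vec (dim_row Q)" by (rule carrier_vecI) simp
  then show ?thesis unfolding True by simp
next
  case False
  then have "0 < x \<bullet> (Q *\<^sub>v x)" using Q x unfolding pos_def_mat_def by blast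
  then show ?thesis by simp
qed

text \<open>The negative definite block matrix is \<open>R - anti_diag_sym K\<close>, so the
  quadratic form of \<open>R\<close> lies below that of \<open>anti_diag_sym K\<close>, which is
  twice the \<open>K\<close> term.\<close>

lemma terminal_bound:
  assumes K: "K \<in> carrier_mat n1 n2" and R: "R \<in> carrier_mat (n1 + n2) (n1 + n2)"
    and split: "split_block R n1 n1 = (R11, R12, R21, R22)"
    and neg: "neg_def_mat (four_block_mat R11 (R12 - K) (R21 - transpose_mat K) R22)"
    and p: "p \<in> carrier_vec n1" and q: "q \<in> carrier_vec n2"
  shows "(p @\<^sub>v q) \<bullet> (R *\<^sub>v (p @\<^sub>v q)) \<le> 2 * (p \<bullet> (K *\<^sub>v q))"
proof -
  let ?Z = "anti_diag_sym K" and ?x = "p @\<^sub>v q"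
  have dims: "dim_row R = n1 + n2" "dim_col R = n1 + n2" using R by auto
  note blocks = split_block[OF split dims]
  have Z: "?Z \<in> carrier_mat (n1 + n2) (n1 + n2)" using K by (rule anti_diag_sym_carrier)
  have "four_block_mat R11 (R12 - K) (R21 - transpose_mat K) R22 = R - ?Z"
    unfolding blocks(5) anti_diag_sym_def using blocks(1-4) K by (intro eq_matI) auto
  then have "pos_def_mat (- (R - ?Z))" using neg by (simp add: neg_def_mat_def)
  moreover have x: "?x \<in> carrier_vec (n1 + n2)" using p q by auto
  ultimately have "0 \<le> ?x \<bullet> (- (R - ?Z) *\<^sub>v ?x)"
    using R Z by (intro pos_def_mat_nonneg) auto
  also have "- (R - ?Z) *\<^sub>v ?x = ?Z *\<^sub>v ?x - R *\<^sub>v ?x"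
  proof -
    have "- (R - ?Z) *\<^sub>v ?x = - (R *\<^sub>v ?x - ?Z *\<^sub>v ?x)"
      using carrier_vecD[OF x] Z by (simp add: minus_mult_distrib_mat_vec[OF R Z x])
    then show ?thesis using R Z by (auto intro!: eq_vecI)
  qed
  also have "?x \<bullet> (?Z *\<^sub>v ?x - R *\<^sub>v ?x) = ?x \<bullet> (?Z *\<^sub>v ?x) - ?x \<bullet> (R *\<^sub>v ?x)"
    using R Z x by (intro scalar_prod_minus_distrib[of _ "n1 + n2"]) (auto intro: mult_mat_vec_carrier)
  finally show ?thesis
    using anti_diag_sym_quadratic_form[OF K p q] by simp
qed

text \<open>Evaluate the positive definite form at the stacked vector of \<open>x\<close> and
  \<open>w\<close>: \<open>L\<close> maps it to the stack of state, state derivative and output, and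
  the middle matrix pairs state with derivative through \<open>R\<close> and the output with itself
  through \<open>M\<close>.\<close>

lemma KYP_quadratic_form:
  fixes A B C D R M :: "real mat"
  assumes A: "A \<in> carrier_mat n n" and B: "B \<in> carrier_mat n k" and C: "C \<in> carrier_mat m n"
    and D: "D \<in> carrier_mat m k" and R: "R \<in> carrier_mat n n" and sym: "transpose_mat R = R"
    and M: "M \<in> carrier_mat m m"
    and L: "L = four_block_mat (1\<^sub>m n) (0\<^sub>m n k) A B @\<^sub>r four_block_mat C D (0\<^sub>m 0 n) (0\<^sub>m 0 k)"
    and pos: "pos_def_mat (transpose_mat L * diag_block_mat [four_block_mat (0\<^sub>m n n) R R (0\<^sub>m n n), M] * L)"
    and x: "x \<in> carrier_vec n" and w: "w \<in> carrier_vec k"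
  shows "0 \<le> 2 * (x \<bullet> (R *\<^sub>v (A *\<^sub>v x + B *\<^sub>v w)))
    + (C *\<^sub>v x + D *\<^sub>v w) \<bullet> (M *\<^sub>v (C *\<^sub>v x + D *\<^sub>v w))"
proof -
  let ?E = "four_block_mat (0\<^sub>m n n) R R (0\<^sub>m n n)"
  let ?W = "diag_block_mat [?E, M]" and ?v = "x @\<^sub>v w"
  let ?g = "A *\<^sub>v x + B *\<^sub>v w" and ?y = "C *\<^sub>v x + D *\<^sub>v w"
  have v: "?v \<in> carrier_vec (n + k)" using x w by auto
  have g: "?g \<in> carrier_vec n" and y: "?y \<in> carrier_vec m" using A B C D x w by auto
  have E: "?E \<in> carrier_mat (n + n) (n + n)" using R by auto
  have W: "?W \<in> carrier_mat ((n + n) + m) ((n + n) + m)"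
    using diag_block_mat_two_carrier[OF E M] .
  have top: "four_block_mat (1\<^sub>m n) (0\<^sub>m n k) A B \<in> carrier_mat (n + n) (n + k)"
    using A B by auto
  have bot: "four_block_mat C D (0\<^sub>m 0 n) (0\<^sub>m 0 k) \<in> carrier_mat m (n + k)"
    using four_block_carrier_mat[OF C, of "0\<^sub>m 0 k" 0 k] by simp
  have Lc: "L \<in> carrier_mat ((n + n) + m) (n + k)"
    unfolding L using top bot by (rule carrier_append_rows)
  have "four_block_mat (1\<^sub>m n) (0\<^sub>m n k) A B *\<^sub>v ?v = x @\<^sub>v ?g"
    using A B x w by (subst four_block_mat_mult_vec[of _ n n _ k _ n]) auto
  \<comment> \<open>The block row of \<open>C\<close> and \<open>D\<close> is a
    \<open>four_block_mat\<close> whose lower blocks have no rows, so the appended vector is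
    empty.\<close>
  moreover have "four_block_mat C D (0\<^sub>m 0 n) (0\<^sub>m 0 k) *\<^sub>v ?v = ?y"
  proof -
    have "four_block_mat C D (0\<^sub>m 0 n) (0\<^sub>m 0 k) *\<^sub>v ?v = ?y @\<^sub>v (0\<^sub>m 0 n *\<^sub>v x + 0\<^sub>m 0 k *\<^sub>v w)"
      using C D x w by (intro four_block_mat_mult_vec) auto
    also have "\<dots> = ?y" by (intro eq_vecI) auto
    finally show ?thesis .
  qed
  ultimately have Lv: "L *\<^sub>v ?v = (x @\<^sub>v ?g) @\<^sub>v ?y"
    unfolding L by (simp add: mat_mult_append[OF top bot v])
  have LT: "transpose_mat L \<in> carrier_mat (n + k) ((n + n) + m)" using Lc by simp
  note LTW = mult_carrier_mat[OF LT W]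
  have "0 \<le> ?v \<bullet> ((transpose_mat L * ?W * L) *\<^sub>v ?v)"
    using pos by (rule pos_def_mat_nonneg) (use carrier_matD[OF mult_carrier_mat[OF LTW Lc]] v in metis)
  also have "(transpose_mat L * ?W * L) *\<^sub>v ?v = transpose_mat L *\<^sub>v (?W *\<^sub>v (L *\<^sub>v ?v))"
    unfolding assoc_mult_mat_vec[OF LTW Lc v] by (rule assoc_mult_mat_vec[OF LT W mult_mat_vec_carrier[OF Lc v]])
  also have "?v \<bullet> \<dots> = (L *\<^sub>v ?v) \<bullet> (?W *\<^sub>v (L *\<^sub>v ?v))"
    using Lc W v by (intro scalar_prod_transpose_mult_vec mult_mat_vec_carrier)
  also have "?W *\<^sub>v (L *\<^sub>v ?v) = (?E *\<^sub>v (x @\<^sub>v ?g)) @\<^sub>v (M *\<^sub>v ?y)"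
    unfolding Lv using x g y by (intro diag_block_mat_two_mult_vec[OF E M]) auto
  also have "?E *\<^sub>v (x @\<^sub>v ?g) = (R *\<^sub>v ?g) @\<^sub>v (R *\<^sub>v x)"
    using R x g by (subst four_block_mat_mult_vec[of _ n n _ n _ n]) auto
  also have "(L *\<^sub>v ?v) \<bullet> (((R *\<^sub>v ?g) @\<^sub>v (R *\<^sub>v x)) @\<^sub>v (M *\<^sub>v ?y)) =
      (x \<bullet> (R *\<^sub>v ?g) + ?g \<bullet> (R *\<^sub>v x)) + ?y \<bullet> (M *\<^sub>v ?y)"
    unfolding Lv using scalar_prod_append[OF x g mult_mat_vec_carrier[OF R g] mult_mat_vec_carrier[OF R x]]
      scalar_prod_append[OF append_carrier_vec[OF x g] y
        append_carrier_vec[OF mult_mat_vec_carrier[OF R g] mult_mat_vec_carrier[OF R x]] mult_mat_vec_carrier[OF M y]]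
    by simp
  also have "?g \<bullet> (R *\<^sub>v x) = x \<bullet> (R *\<^sub>v ?g)"
    using scalar_prod_transpose_mult_vec[OF R x g] comm_scalar_prod[OF g mult_mat_vec_carrier[OF R x]]
    by (simp add: sym)
  finally show ?thesis by simp
qed

subsection \<open>The finite-horizon IQC\<close>

text \<open>Block-diagonal state and input matrices decouple the joint filter: the upper and lower
  parts of \<open>\<xi>\<close> see only the upper and lower parts of \<open>T u\<close>.\<close>

lemma filter_trajectory_diag_driven_by:
  assumes A1: "A1 \<in> carrier_mat n1 n1" and B1: "B1 \<in> carrier_mat n1 k"
    and A2: "A2 \<in> carrier_mat n2 n2" and B2: "B2 \<in> carrier_mat n2 k"
    and T: "T \<in> carrier_mat (k + k) l"
    and traj: "filter_trajectory (diag_block_mat [A1, A2]) (diag_block_mat [B1, B2] * T) C D u \<xi> y"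
    and u: "\<And>t. 0 \<le> t \<Longrightarrow> u t \<in> carrier_vec l"
    and Tu: "\<And>t. 0 \<le> t \<Longrightarrow> T *\<^sub>v u t = v1 t @\<^sub>v v2 t"
    and v1: "\<And>t. 0 \<le> t \<Longrightarrow> v1 t \<in> carrier_vec k" and v2: "\<And>t. 0 \<le> t \<Longrightarrow> v2 t \<in> carrier_vec k"
  shows "driven_by n1 A1 B1 v1 (\<lambda>t. vec_first (\<xi> t) n1)" and "driven_by n2 A2 B2 v2 (\<lambda>t. vec_last (\<xi> t) n2)"
proof -
  let ?A = "diag_block_mat [A1, A2]" and ?B = "diag_block_mat [B1, B2]"
  let ?x1 = "\<lambda>t. vec_first (\<xi> t) n1" and ?x2 = "\<lambda>t. vec_last (\<xi> t) n2"
  have A: "?A \<in> carrier_mat (n1 + n2) (n1 + n2)" and B: "?B \<in> carrier_mat (n1 + n2) (k + k)"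
    by (intro diag_block_mat_two_carrier A1 A2 B1 B2)+
  then have dim: "dim_row ?A = n1 + n2" by blast
  have \<xi>: "\<xi> t \<in> carrier_vec (n1 + n2)" if "0 \<le> t" for t
    using traj that unfolding filter_trajectory_def dim by blast
  have ii: "indef_integral (\<lambda>t. (?A *\<^sub>v \<xi> t + (?B * T) *\<^sub>v u t) $ i) (\<lambda>t. \<xi> t $ i)" if "i < n1 + n2" for i
    using traj that unfolding filter_trajectory_def dim indef_integral_def by blast
  have rhs: "?A *\<^sub>v \<xi> t + (?B * T) *\<^sub>v u t =
      (A1 *\<^sub>v ?x1 t + B1 *\<^sub>v v1 t) @\<^sub>v (A2 *\<^sub>v ?x2 t + B2 *\<^sub>v v2 t)" if t: "0 \<le> t" for t
  proof -
    have "?A *\<^sub>v \<xi> t = ?A *\<^sub>v (?x1 t @\<^sub>v ?x2 t)" using \<xi>[OF t] by simp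
    also have "\<dots> = (A1 *\<^sub>v ?x1 t) @\<^sub>v (A2 *\<^sub>v ?x2 t)"
      by (intro diag_block_mat_two_mult_vec[OF A1 A2]) auto
    finally have "?A *\<^sub>v \<xi> t = (A1 *\<^sub>v ?x1 t) @\<^sub>v (A2 *\<^sub>v ?x2 t)" .
    moreover have "(?B * T) *\<^sub>v u t = (B1 *\<^sub>v v1 t) @\<^sub>v (B2 *\<^sub>v v2 t)"
      unfolding assoc_mult_mat_vec[OF B T u[OF t]] Tu[OF t]
      by (rule diag_block_mat_two_mult_vec[OF B1 B2 v1[OF t] v2[OF t]])
    ultimately show ?thesis
      using A1 A2 B1 B2 v1[OF t] v2[OF t] by (simp add: append_vec_add[of _ n1 _ _ n2])
  qed
  show "driven_by n1 A1 B1 v1 ?x1"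
    unfolding driven_by_def
  proof (intro conjI allI impI)
    fix i assume i: "i < n1"
    have "(?A *\<^sub>v \<xi> t + (?B * T) *\<^sub>v u t) $ i = (A1 *\<^sub>v ?x1 t + B1 *\<^sub>v v1 t) $ i \<and> \<xi> t $ i = ?x1 t $ i"
      if t: "0 \<le> t" for t
      unfolding rhs[OF t] using i A1 B1 A2 B2 \<xi>[OF t] by (auto simp: vec_first_def)
    then have "indef_integral (\<lambda>t. (?A *\<^sub>v \<xi> t + (?B * T) *\<^sub>v u t) $ i) (\<lambda>t. \<xi> t $ i) \<longleftrightarrow>
        indef_integral (\<lambda>t. (A1 *\<^sub>v ?x1 t + B1 *\<^sub>v v1 t) $ i) (\<lambda>t. ?x1 t $ i)"
      by (intro indef_integral_cong) blast+
    then show "indef_integral (\<lambda>t. (A1 *\<^sub>v ?x1 t + B1 *\<^sub>v v1 t) $ i) (\<lambda>t. ?x1 t $ i)"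
      using ii i by simp
  qed simp
  show "driven_by n2 A2 B2 v2 ?x2"
    unfolding driven_by_def
  proof (intro conjI allI impI)
    fix i assume i: "i < n2"
    \<comment> \<open>Component \<open>i\<close> of the second filter sits at position
      \<open>n1 + i\<close> of the joint state.\<close>
    have "(?A *\<^sub>v \<xi> t + (?B * T) *\<^sub>v u t) $ (n1 + i) = (A2 *\<^sub>v ?x2 t + B2 *\<^sub>v v2 t) $ i \<and> \<xi> t $ (n1 + i) = ?x2 t $ i"
      if t: "0 \<le> t" for t
      unfolding rhs[OF t] using i A1 B1 A2 B2 \<xi>[OF t] by (auto simp: vec_last_def)
    then have "indef_integral (\<lambda>t. (?A *\<^sub>v \<xi> t + (?B * T) *\<^sub>v u t) $ (n1 + i)) (\<lambda>t. \<xi> t $ (n1 + i)) \<longleftrightarrow>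
        indef_integral (\<lambda>t. (A2 *\<^sub>v ?x2 t + B2 *\<^sub>v v2 t) $ i) (\<lambda>t. ?x2 t $ i)"
      by (intro indef_integral_cong) blast+
    then show "indef_integral (\<lambda>t. (A2 *\<^sub>v ?x2 t + B2 *\<^sub>v v2 t) $ i) (\<lambda>t. ?x2 t $ i)"
      using ii i by simp
  qed simp
qed

theorem theorem13:
  fixes \<alpha> \<beta> :: real and nz m1 m2 n1 n2 :: nat
    and \<psi>1 \<psi>2 :: "real poly fract mat"
    and A1 B1 C1 D1 A2 B2 C2 D2 A\<Psi> B\<Psi> C\<Psi> D\<Psi> J T :: "real mat"
    and P M R R11 R12 R21 R22 K L :: "real mat"
    and \<Delta> :: "(real \<Rightarrow> real vec) \<Rightarrow> (real \<Rightarrow> real vec)"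
  assumes "\<alpha> < 0" and "0 < \<beta>"
    and "\<psi>1 \<in> carrier_mat m1 nz" and "stable_proper \<psi>1"
    and "minimal_realization \<psi>1 n1 A1 B1 C1 D1"
    and "\<psi>2 \<in> carrier_mat m2 nz" and "stable_proper \<psi>2"
    and "minimal_realization \<psi>2 n2 A2 B2 C2 D2"
    and "A\<Psi> = diag_block_mat [A1, A2]" and "B\<Psi> = diag_block_mat [B1, B2]"
    and "C\<Psi> = diag_block_mat [C1, C2]" and "D\<Psi> = diag_block_mat [D1, D2]"
    and "J = J_mat nz" and "T = T_mat \<alpha> \<beta> nz"
    and "P \<in> carrier_mat m1 m2" and "M = anti_diag_sym P"
    and "R \<in> carrier_mat (n1 + n2) (n1 + n2)" and "transpose_mat R = R"
    and "split_block R n1 n1 = (R11, R12, R21, R22)"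
    and "K \<in> carrier_mat n1 n2"
    and "L = four_block_mat (1\<^sub>m (n1 + n2)) (0\<^sub>m (n1 + n2) nz) A\<Psi> (B\<Psi> * J)
             @\<^sub>r four_block_mat C\<Psi> (D\<Psi> * J) (0\<^sub>m 0 (n1 + n2)) (0\<^sub>m 0 nz)"
    and "pos_def_mat (transpose_mat L *
           diag_block_mat
             [four_block_mat (0\<^sub>m (n1 + n2) (n1 + n2)) R R (0\<^sub>m (n1 + n2) (n1 + n2)), M] * L)"
    and "neg_def_mat (four_block_mat R11 (R12 - K) (R21 - transpose_mat K) R22)"
    and "\<Delta> \<in> mult_ops \<alpha> \<beta> nz"
  shows "finite_horizon_IQC nz A\<Psi> B\<Psi> C\<Psi> D\<Psi> T M (anti_diag_sym K) \<Delta>"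
proof -
  note \<Psi>_def = assms(9-12) and J_def = assms(13) and T_def = assms(14) and M_def = assms(16)
  have c1: "A1 \<in> carrier_mat n1 n1" "B1 \<in> carrier_mat n1 nz" "C1 \<in> carrier_mat m1 n1" "D1 \<in> carrier_mat m1 nz"
    using assms(3,5) by (auto simp: minimal_realization_def realization_def)
  have c2: "A2 \<in> carrier_mat n2 n2" "B2 \<in> carrier_mat n2 nz" "C2 \<in> carrier_mat m2 n2" "D2 \<in> carrier_mat m2 nz"
    using assms(6,8) by (auto simp: minimal_realization_def realization_def)
  have A\<Psi>: "A\<Psi> \<in> carrier_mat (n1 + n2) (n1 + n2)" and B\<Psi>: "B\<Psi> \<in> carrier_mat (n1 + n2) (nz + nz)"
    and C\<Psi>: "C\<Psi> \<in> carrier_mat (m1 + m2) (n1 + n2)" and D\<Psi>: "D\<Psi> \<in> carrier_mat (m1 + m2) (nz + nz)"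
    unfolding \<Psi>_def by (intro diag_block_mat_two_carrier c1 c2)+
  have J: "J \<in> carrier_mat (nz + nz) nz" unfolding J_def by (rule J_mat_carrier)
  have T: "T \<in> carrier_mat (nz + nz) (nz + nz)" unfolding T_def by (rule T_mat_carrier)
  have P: "P \<in> carrier_mat m1 m2" and K: "K \<in> carrier_mat n1 n2" using assms(15,20) by auto
  have M: "M \<in> carrier_mat (m1 + m2) (m1 + m2)" unfolding M_def by (rule anti_diag_sym_carrier[OF P])
  have BJ: "B\<Psi> * J \<in> carrier_mat (n1 + n2) nz" and DJ: "D\<Psi> * J \<in> carrier_mat (m1 + m2) nz"
    using B\<Psi> D\<Psi> J by auto
  interpret dissipative_filter_pair n1 n2 m1 m2 nz A1 B1 C1 D1 A2 B2 C2 D2 P R K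
  proof
    fix p q w :: "real vec"
    assume p: "p \<in> carrier_vec n1" and q: "q \<in> carrier_vec n2" and w: "w \<in> carrier_vec nz"
    have pq: "p @\<^sub>v q \<in> carrier_vec (n1 + n2)" using p q by auto
    \<comment> \<open>Multiplication by \<open>J\<close> duplicates \<open>w\<close>, so both
      filters receive the same input.\<close>
    have Bw: "(B\<Psi> * J) *\<^sub>v w = (B1 *\<^sub>v w) @\<^sub>v (B2 *\<^sub>v w)"
      unfolding assoc_mult_mat_vec[OF B\<Psi> J w] unfolding J_def J_mat_mult_vec[OF w] \<Psi>_def
      by (rule diag_block_mat_two_mult_vec[OF c1(2) c2(2) w w])
    have Dw: "(D\<Psi> * J) *\<^sub>v w = (D1 *\<^sub>v w) @\<^sub>v (D2 *\<^sub>v w)"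
      unfolding assoc_mult_mat_vec[OF D\<Psi> J w] unfolding J_def J_mat_mult_vec[OF w] \<Psi>_def
      by (rule diag_block_mat_two_mult_vec[OF c1(4) c2(4) w w])
    have g: "A\<Psi> *\<^sub>v (p @\<^sub>v q) + (B\<Psi> * J) *\<^sub>v w = (A1 *\<^sub>v p + B1 *\<^sub>v w) @\<^sub>v (A2 *\<^sub>v q + B2 *\<^sub>v w)"
      unfolding Bw unfolding \<Psi>_def diag_block_mat_two_mult_vec[OF c1(1) c2(1) p q]
      by (rule append_vec_add)
        (rule mult_mat_vec_carrier[OF _ p] mult_mat_vec_carrier[OF _ q] mult_mat_vec_carrier[OF _ w], rule c1 c2)+
    have y: "C\<Psi> *\<^sub>v (p @\<^sub>v q) + (D\<Psi> * J) *\<^sub>v w = (C1 *\<^sub>v p + D1 *\<^sub>v w) @\<^sub>v (C2 *\<^sub>v q + D2 *\<^sub>v w)"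
      unfolding Dw unfolding \<Psi>_def diag_block_mat_two_mult_vec[OF c1(3) c2(3) p q]
      by (rule append_vec_add)
        (rule mult_mat_vec_carrier[OF _ p] mult_mat_vec_carrier[OF _ q] mult_mat_vec_carrier[OF _ w], rule c1 c2)+
    have y12: "C1 *\<^sub>v p + D1 *\<^sub>v w \<in> carrier_vec m1" "C2 *\<^sub>v q + D2 *\<^sub>v w \<in> carrier_vec m2"
      using c1 c2 p q w by auto
    show "0 \<le> (p @\<^sub>v q) \<bullet> (R *\<^sub>v ((A1 *\<^sub>v p + B1 *\<^sub>v w) @\<^sub>v (A2 *\<^sub>v q + B2 *\<^sub>v w)))
        + (C1 *\<^sub>v p + D1 *\<^sub>v w) \<bullet> (P *\<^sub>v (C2 *\<^sub>v q + D2 *\<^sub>v w))"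
      \<comment> \<open>The output form of \<open>M\<close> is twice the \<open>P\<close> product,
        so the factor 2 is common to both terms and cancels.\<close>
      using KYP_quadratic_form[OF A\<Psi> BJ C\<Psi> DJ assms(17,18) M assms(21,22) pq w]
      unfolding g y M_def anti_diag_sym_quadratic_form[OF P y12] by simp
  next
    show "(p @\<^sub>v q) \<bullet> (R *\<^sub>v (p @\<^sub>v q)) \<le> 2 * (p \<bullet> (K *\<^sub>v q))"
      if "p \<in> carrier_vec n1" "q \<in> carrier_vec n2" for p q
      using terminal_bound[OF K assms(17,19,23) that] .
  qed (use c1 c2 P K assms(17,18) in simp_all)
  obtain \<delta> where \<delta>: "\<alpha> \<le> \<delta>" "\<delta> \<le> \<beta>" and \<Delta>: "\<And>z t. z \<in> L2e nz \<Longrightarrow> 0 \<le> t \<Longrightarrow> \<Delta> z t = \<delta> \<cdot>\<^sub>v z t"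
    using assms(24) by (auto simp: mult_ops_def)
  \<comment> \<open>These are the gains produced by \<open>T\<close>; they are nonnegative because
    \<open>\<delta>\<close> lies in the interval and \<open>\<beta>\<close> is positive.\<close>
  define a b where "a = 1 - \<delta> / \<beta>" and "b = \<delta> - \<alpha>"
  have ab: "0 \<le> a" "0 \<le> b" using \<delta> \<open>0 < \<beta>\<close> by (auto simp: a_def b_def)
  show ?thesis
    unfolding finite_horizon_IQC_def
  proof (intro conjI ballI allI impI)
    show "transpose_mat (anti_diag_sym K) = anti_diag_sym K" by (rule anti_diag_sym_transpose)
    fix z \<xi> y and \<theta> :: real
    assume z: "z \<in> L2e nz" and "0 < \<theta>"
      and traj: "filter_trajectory A\<Psi> (B\<Psi> * T) C\<Psi> (D\<Psi> * T) (\<lambda>t. z t @\<^sub>v \<Delta> z t) \<xi> y"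
    have zc: "z t \<in> carrier_vec nz" if "0 \<le> t" for t using z that by (simp add: L2e_def)
    have u: "z t @\<^sub>v \<Delta> z t \<in> carrier_vec (nz + nz)" if "0 \<le> t" for t
      using zc[OF that] by (simp add: \<Delta>[OF z that])
    have Tu: "T *\<^sub>v (z t @\<^sub>v \<Delta> z t) = (a \<cdot>\<^sub>v z t) @\<^sub>v (b \<cdot>\<^sub>v z t)" if "0 \<le> t" for t
      unfolding \<Delta>[OF z that] T_def a_def b_def by (rule T_mat_mult_vec[OF zc[OF that]])
    define x1 x2 where "x1 = (\<lambda>t. vec_first (\<xi> t) n1)" and "x2 = (\<lambda>t. vec_last (\<xi> t) n2)"
    have x1: "driven_by n1 A1 B1 (\<lambda>t. a \<cdot>\<^sub>v z t) x1" and x2: "driven_by n2 A2 B2 (\<lambda>t. b \<cdot>\<^sub>v z t) x2"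
      using filter_trajectory_diag_driven_by[OF c1(1,2) c2(1,2) T traj[unfolded assms(9,10)] u Tu] zc
      by (auto simp: x1_def x2_def)
    have x12: "x1 t \<in> carrier_vec n1" "x2 t \<in> carrier_vec n2" for t by (auto simp: x1_def x2_def)
    have \<xi>: "\<xi> t = x1 t @\<^sub>v x2 t" if "0 \<le> t" for t
      using traj that A\<Psi> by (simp add: filter_trajectory_def x1_def x2_def)
    let ?y1 = "\<lambda>t. C1 *\<^sub>v x1 t + D1 *\<^sub>v (a \<cdot>\<^sub>v z t)" and ?y2 = "\<lambda>t. C2 *\<^sub>v x2 t + D2 *\<^sub>v (b \<cdot>\<^sub>v z t)"
    have y: "y t \<bullet> (M *\<^sub>v y t) = 2 * (?y1 t \<bullet> (P *\<^sub>v ?y2 t))" if t: "0 \<le> t" for t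
    proof -
      have az: "a \<cdot>\<^sub>v z t \<in> carrier_vec nz" "b \<cdot>\<^sub>v z t \<in> carrier_vec nz" using zc[OF t] by auto
      have "y t = C\<Psi> *\<^sub>v \<xi> t + (D\<Psi> * T) *\<^sub>v (z t @\<^sub>v \<Delta> z t)"
        using traj t by (simp add: filter_trajectory_def)
      also have "\<dots> = ((C1 *\<^sub>v x1 t) @\<^sub>v (C2 *\<^sub>v x2 t)) + ((D1 *\<^sub>v (a \<cdot>\<^sub>v z t)) @\<^sub>v (D2 *\<^sub>v (b \<cdot>\<^sub>v z t)))"
        unfolding assoc_mult_mat_vec[OF D\<Psi> T u[OF t]] Tu[OF t] \<xi>[OF t]
        unfolding \<Psi>_def diag_block_mat_two_mult_vec[OF c1(3) c2(3) x12]
          diag_block_mat_two_mult_vec[OF c1(4) c2(4) az] ..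
      also have "\<dots> = ?y1 t @\<^sub>v ?y2 t"
        by (rule append_vec_add)
          (rule mult_mat_vec_carrier[OF _ x12(1)] mult_mat_vec_carrier[OF _ x12(2)]
            mult_mat_vec_carrier[OF _ az(1)] mult_mat_vec_carrier[OF _ az(2)], rule c1 c2)+
      finally have y: "y t = ?y1 t @\<^sub>v ?y2 t" .
      show ?thesis unfolding y M_def
        using c1 c2 x12[of t] az by (intro anti_diag_sym_quadratic_form[OF P]) auto
    qed
    have "(LINT t:{0..\<theta>}|lebesgue. y t \<bullet> (M *\<^sub>v y t)) =
        (LINT t:{0..\<theta>}|lebesgue. 2 * (?y1 t \<bullet> (P *\<^sub>v ?y2 t)))"
      using y by (intro set_lebesgue_integral_cong) auto
    moreover have "\<xi> \<theta> \<bullet> (anti_diag_sym K *\<^sub>v \<xi> \<theta>) = 2 * (x1 \<theta> \<bullet> (K *\<^sub>v x2 \<theta>))"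
      using \<xi>[of \<theta>] \<open>0 < \<theta>\<close> by (simp add: anti_diag_sym_quadratic_form[OF K x12])
    \<comment> \<open>Integral and terminal cost are both twice the terms of
      \<open>IQC_scaled_inputs\<close>.\<close>
    ultimately show "0 \<le> (LINT t:{0..\<theta>}|lebesgue. y t \<bullet> (M *\<^sub>v y t)) + \<xi> \<theta> \<bullet> (anti_diag_sym K *\<^sub>v \<xi> \<theta>)"
      using IQC_scaled_inputs[OF z ab x1 x2, of \<theta>] \<open>0 < \<theta>\<close> by simp
  qed
qed

end
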